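(* Let $r(t,u)=\dfrac{1}{1+(t-u)^2}$, $t,u\in\mathbb{R}$, be the Cauchy kernel. For $m\in\mathbb{N}_0$ define $$\psi_m(t)=-\frac{1}{\sqrt2}\frac{(it)^m}{(it-1)^{m+1}},\qquad \psi_{-m-1}(t)=-\frac{1}{\sqrt2}\frac{(it)^m}{(it+1)^{m+1}},$$ and $$\alpha_m(t)=\frac{1}{\sqrt2}\big(\psi_m(t)+\psi_m^*(t)\big),\qquad \beta_m(t)=\frac{1}{i\sqrt2}\big(\psi_m(t)-\psi_m^*(t)\big).$$ Then $\{\psi_m\}_{m\in\mathbb{Z}}$ is an orthonormal basis of the reproducing kernel Hilbert space of $r$, and so is $\{\alpha_m\}_{m\in\mathbb{N}_0}\cup\{\beta_m\}_{m\in\mathbb{N}_0}$. Consequently, with pointwise convergence, $$r(t,u)=\sum_{m=-\infty}^\infty\psi_m^*(t)\psi_m(u)=\sum_{m=0}^\infty\alpha_m(t)\alpha_m(u)+\sum_{m=0}^\infty\beta_m(t)\beta_m(u)$$ for all $t,u\in\mathbb{R}$.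
   Context: $z^*$ denotes the complex conjugate of $z\in\mathbb{C}$, and $\mathbb{N}_0=\{0,1,2,\ldots\}$. The reproducing kernel Hilbert space of $r$ is the unique Hilbert space of complex-valued functions on $\mathbb{R}$ with reproducing kernel $r$. *)

theory Defs
  imports "HOL-Analysis.Analysis"
begin

section \<open>Complex Hilbert spaces of functions\<close>

definition ip_norm :: "(('a \<Rightarrow> complex) \<Rightarrow> ('a \<Rightarrow> complex) \<Rightarrow> complex) \<Rightarrow> ('a \<Rightarrow> complex) \<Rightarrow> real"
  where "ip_norm ip f = sqrt (Re (ip f f))"

text \<open>The inner product is linear in its first argument. It is only constrained on \<open>H\<close>;
  its values elsewhere are irrelevant. Hermitian symmetry makes \<open>ip f f\<close> real, so
  \<open>pos\<close> and \<open>definite\<close> together are positive definiteness.\<close>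

locale function_hilbert_space =
  fixes H :: "('a \<Rightarrow> complex) set"
    and ip :: "('a \<Rightarrow> complex) \<Rightarrow> ('a \<Rightarrow> complex) \<Rightarrow> complex"
  assumes zero_mem: "(\<lambda>x. 0) \<in> H"
    and add_mem: "\<And>f g. f \<in> H \<Longrightarrow> g \<in> H \<Longrightarrow> (\<lambda>x. f x + g x) \<in> H"
    and scale_mem: "\<And>c f. f \<in> H \<Longrightarrow> (\<lambda>x. c * f x) \<in> H"
    and ip_add: "\<And>f g h. f \<in> H \<Longrightarrow> g \<in> H \<Longrightarrow> h \<in> H \<Longrightarrow>
      ip (\<lambda>x. f x + g x) h = ip f h + ip g h"
    and ip_scale: "\<And>c f g. f \<in> H \<Longrightarrow> g \<in> H \<Longrightarrow> ip (\<lambda>x. c * f x) g = c * ip f g"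
    and ip_commute: "\<And>f g. f \<in> H \<Longrightarrow> g \<in> H \<Longrightarrow> ip g f = cnj (ip f g)"
    and pos: "\<And>f. f \<in> H \<Longrightarrow> 0 \<le> Re (ip f f)"
    and definite: "\<And>f. f \<in> H \<Longrightarrow> ip f f = 0 \<Longrightarrow> f = (\<lambda>x. 0)"
    and complete: "\<And>F :: nat \<Rightarrow> 'a \<Rightarrow> complex. (\<And>n. F n \<in> H) \<Longrightarrow>
      (\<And>e. e > 0 \<Longrightarrow> \<exists>N. \<forall>m\<ge>N. \<forall>n\<ge>N. ip_norm ip (\<lambda>x. F m x - F n x) < e) \<Longrightarrow>
      \<exists>f\<in>H. (\<lambda>n. ip_norm ip (\<lambda>x. F n x - f x)) \<longlonglongrightarrow> 0"

text \<open>\<open>H\<close> with inner product \<open>ip\<close> is the reproducing kernel Hilbert space of \<open>K\<close>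
  (unique by the Moore--Aronszajn theorem).\<close>

locale rkhs = function_hilbert_space H ip
  for K :: "'a \<Rightarrow> 'a \<Rightarrow> complex"
    and H :: "('a \<Rightarrow> complex) set"
    and ip :: "('a \<Rightarrow> complex) \<Rightarrow> ('a \<Rightarrow> complex) \<Rightarrow> complex" +
  assumes kernel_mem: "\<And>t. (\<lambda>u. K t u) \<in> H"
    and reproducing: "\<And>f t. f \<in> H \<Longrightarrow> ip f (\<lambda>u. K t u) = f t"

text \<open>An orthonormal family whose finite linear combinations are dense in \<open>H\<close>. Being indexed,
  the family consists of pairwise distinct functions.\<close>

definition orthonormal_basis ::
  "('a \<Rightarrow> complex) set \<Rightarrow> (('a \<Rightarrow> complex) \<Rightarrow> ('a \<Rightarrow> complex) \<Rightarrow> complex) \<Rightarrow>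
    ('i \<Rightarrow> 'a \<Rightarrow> complex) \<Rightarrow> bool"
  where "orthonormal_basis H ip e \<longleftrightarrow>
    (\<forall>i. e i \<in> H) \<and>
    (\<forall>i j. ip (e i) (e j) = (if i = j then 1 else 0)) \<and>
    (\<forall>f\<in>H. \<forall>\<epsilon>>0. \<exists>S c. finite S \<and> ip_norm ip (\<lambda>x. f x - (\<Sum>i\<in>S. c i * e i x)) < \<epsilon>)"

section \<open>The Cauchy kernel\<close>

definition cauchy_kernel :: "real \<Rightarrow> real \<Rightarrow> complex"
  where "cauchy_kernel t u = complex_of_real (1 / (1 + (t - u)\<^sup>2))"

text \<open>For \<open>m < 0\<close> the exponent is the \<open>k\<close> with \<open>m = - k - 1\<close>.\<close>

definition psi :: "int \<Rightarrow> real \<Rightarrow> complex"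
  where "psi m t =
    (if 0 \<le> m
     then - (1 / complex_of_real (sqrt 2)) *
       ((\<i> * complex_of_real t) ^ nat m / (\<i> * complex_of_real t - 1) ^ (nat m + 1))
     else - (1 / complex_of_real (sqrt 2)) *
       ((\<i> * complex_of_real t) ^ nat (- m - 1) /
         (\<i> * complex_of_real t + 1) ^ (nat (- m - 1) + 1)))"

definition alpha :: "nat \<Rightarrow> real \<Rightarrow> complex"
  where "alpha m t = 1 / complex_of_real (sqrt 2) * (psi (int m) t + cnj (psi (int m) t))"

definition beta :: "nat \<Rightarrow> real \<Rightarrow> complex"
  where "beta m t =
    1 / (\<i> * complex_of_real (sqrt 2)) * (psi (int m) t - cnj (psi (int m) t))"

end

theory Submission
  imports Defs "HOL-Complex_Analysis.Complex_Analysis"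
begin

text \<open>
  The space \<open>H\<close> is only known through its reproducing property, so even the membership of the
  functions \<open>psi m\<close> in it has to be proved. This rests on a general principle: if a kernel has a
  pointwise expansion \<open>K t u = (\<Sum>i. cnj (e i t) * e i u)\<close>, then every \<open>e i\<close> belongs to \<open>H\<close>, and if in
  addition the \<open>e i\<close> admit no nontrivial relation with square-summable coefficients
  (\<open>l2_independent\<close>), they form an orthonormal basis. Indeed the expansion says that
  \<open>K t \<mapsto> (cnj (e i t))\<^sub>i\<close> is isometric from the span of the kernel functions into \<open>\<ell>\<^sup>2\<close>; pulling back the
  functional given by a finite sequence \<open>c\<close> and applying the Riesz theorem produces
  \<open>\<Sum>i. c i * e i\<close> in \<open>H\<close>, with norm at most that of \<open>c\<close> (\<open>finite_comb\<close>). By duality every \<open>h\<close> in \<open>H\<close>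
  has square-summable coefficients \<open>\<langle>h, e i\<rangle>\<close> and the pointwise expansion \<open>\<Sum>i. \<langle>h, e i\<rangle> e i\<close>
  (\<open>value_expansion\<close>). Independence applied to the expansion of \<open>e k\<close> gives orthonormality, and an
  element orthogonal to all \<open>e i\<close> vanishes pointwise.

  For the Cauchy kernel, the expansion over \<open>psi\<close> consists of two complex conjugate geometric series
  with ratio of modulus below one (\<open>half_kernel\<close>). The independence (\<open>psi_independent\<close>) is a
  statement on Hardy spaces of two overlapping half-planes. With \<open>z = \<i> t\<close>, the part of
  \<open>\<Sum>m. a m * psi m t\<close> with \<open>m \<ge> 0\<close> is a power series in \<open>z / (z - 1)\<close> divided by \<open>z - 1\<close>, holomorphic for
  \<open>Re z < 1/2\<close>, and the rest is the mirror image, holomorphic for \<open>Re z > -1/2\<close>. If the sum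
  vanishes on the imaginary axis, the two parts continue each other, up to sign, to an entire function, which is
  bounded by the Cauchy--Schwarz inequality for the coefficients and tends to zero along the
  negative real axis; by Liouville's theorem it is zero (\<open>half_series_unique\<close>). The statements on
  \<open>alpha\<close> and \<open>beta\<close> follow by a unitary change of basis in the span of each pair
  \<open>psi m\<close>, \<open>psi (- m - 1)\<close>.
\<close>

section \<open>Hilbert spaces of functions\<close>

context function_hilbert_space
begin

lemma diff_mem: "f \<in> H \<Longrightarrow> g \<in> H \<Longrightarrow> (\<lambda>x. f x - g x) \<in> H"
  using add_mem[of f "\<lambda>x. - 1 * g x"] scale_mem[of g "- 1"] by simp

lemma sum_mem: "(\<And>i. i \<in> S \<Longrightarrow> f i \<in> H) \<Longrightarrow> (\<lambda>x. \<Sum>i\<in>S. f i x) \<in> H"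
proof (induction S rule: infinite_finite_induct)
  case (insert i S)
  then show ?case using add_mem[of "f i" "\<lambda>x. \<Sum>i\<in>S. f i x"] by simp
qed (auto simp: zero_mem)

lemma ip_zero_left: "g \<in> H \<Longrightarrow> ip (\<lambda>x. 0) g = 0"
  using ip_scale[OF zero_mem, of g 0] by simp

lemma ip_zero_right: "g \<in> H \<Longrightarrow> ip g (\<lambda>x. 0) = 0"
  using ip_commute[OF zero_mem, of g] ip_zero_left[of g] by simp

lemma ip_add_right:
  "f \<in> H \<Longrightarrow> g \<in> H \<Longrightarrow> h \<in> H \<Longrightarrow> ip h (\<lambda>x. f x + g x) = ip h f + ip h g"
  using ip_commute[of "\<lambda>x. f x + g x" h] add_mem[of f g] ip_add[of f g h]
    ip_commute[of f h] ip_commute[of g h] by simp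

lemma ip_scale_right:
  "f \<in> H \<Longrightarrow> g \<in> H \<Longrightarrow> ip f (\<lambda>x. c * g x) = cnj c * ip f g"
  using ip_commute[of "\<lambda>x. c * g x" f] scale_mem[of g c] ip_scale[of g f c]
    ip_commute[of g f] by simp

lemma ip_diff:
  "f \<in> H \<Longrightarrow> g \<in> H \<Longrightarrow> h \<in> H \<Longrightarrow> ip (\<lambda>x. f x - g x) h = ip f h - ip g h"
  using ip_add[of f "\<lambda>x. - 1 * g x" h] scale_mem[of g "- 1"] ip_scale[of g h "- 1"] by simp

lemma ip_sum:
  "(\<And>i. i \<in> S \<Longrightarrow> f i \<in> H) \<Longrightarrow> h \<in> H \<Longrightarrow> ip (\<lambda>x. \<Sum>i\<in>S. f i x) h = (\<Sum>i\<in>S. ip (f i) h)"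
proof (induction S rule: infinite_finite_induct)
  case (insert i S)
  then show ?case using ip_add[of "f i" "\<lambda>x. \<Sum>i\<in>S. f i x" h] sum_mem[of S f] by simp
qed (auto simp: ip_zero_left)

lemma comb_mem: "(\<And>i. i \<in> S \<Longrightarrow> f i \<in> H) \<Longrightarrow> (\<lambda>x. \<Sum>i\<in>S. c i * f i x) \<in> H"
  using sum_mem[of S "\<lambda>i x. c i * f i x"] scale_mem by blast

lemma ip_comb:
  assumes "\<And>i. i \<in> S \<Longrightarrow> f i \<in> H" "h \<in> H"
  shows "ip (\<lambda>x. \<Sum>i\<in>S. c i * f i x) h = (\<Sum>i\<in>S. c i * ip (f i) h)"
  using ip_sum[of S "\<lambda>i x. c i * f i x" h] scale_mem assms by (simp add: ip_scale)

lemma ip_comb_right: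
  assumes "\<And>i. i \<in> S \<Longrightarrow> f i \<in> H" "h \<in> H"
  shows "ip h (\<lambda>x. \<Sum>i\<in>S. c i * f i x) = (\<Sum>i\<in>S. cnj (c i) * ip h (f i))"
proof -
  have "ip h (\<lambda>x. \<Sum>i\<in>S. c i * f i x) = cnj (\<Sum>i\<in>S. c i * ip (f i) h)"
    using ip_commute[OF comb_mem[of S f c] assms(2)] ip_comb[of S f h c] assms by simp
  also have "\<dots> = (\<Sum>i\<in>S. cnj (c i) * ip h (f i))"
    unfolding cnj_sum complex_cnj_mult
    by (intro sum.cong refl arg_cong2[where f = "(*)"] ip_commute[symmetric]) (auto simp: assms)
  finally show ?thesis .
qed

lemma ip_self: "f \<in> H \<Longrightarrow> ip f f = complex_of_real ((ip_norm ip f)\<^sup>2)"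
  using ip_commute[of f f] pos[of f] by (simp add: ip_norm_def complex_eq_iff)

lemma norm_nonneg: "f \<in> H \<Longrightarrow> 0 \<le> ip_norm ip f"
  using pos[of f] by (simp add: ip_norm_def)

lemma norm_eq_zero: "f \<in> H \<Longrightarrow> ip_norm ip f = 0 \<Longrightarrow> f = (\<lambda>x. 0)"
  using ip_self[of f] definite[of f] by simp

lemma norm_add_scale:
  assumes "f \<in> H" "g \<in> H"
  shows "(ip_norm ip (\<lambda>x. f x + c * g x))\<^sup>2 =
    (ip_norm ip f)\<^sup>2 + 2 * Re (cnj c * ip f g) + (cmod c)\<^sup>2 * (ip_norm ip g)\<^sup>2"
proof -
  let ?h = "\<lambda>x. f x + c * g x"
  have m: "(\<lambda>x. c * g x) \<in> H" "?h \<in> H"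
    using scale_mem[of g c] add_mem[of f "\<lambda>x. c * g x"] assms by auto
  have "ip ?h ?h = ip f f + cnj c * ip f g + c * cnj (ip f g) + c * cnj c * ip g g"
    using m assms
    by (simp add: ip_add ip_add_right ip_scale ip_scale_right ip_commute[of f g] algebra_simps)
  also have "c * cnj (ip f g) = cnj (cnj c * ip f g)" by simp
  finally have "Re (ip ?h ?h) = Re (ip f f) + 2 * Re (cnj c * ip f g) + Re (c * cnj c * ip g g)"
    by simp
  then show ?thesis
    unfolding ip_self[OF m(2)] ip_self[OF assms(1)] ip_self[OF assms(2)] complex_norm_square[symmetric]
    by (simp add: complex_norm_square[symmetric] del: of_real_power flip: of_real_mult)
qed

lemma norm_diff:
  assumes "f \<in> H" "g \<in> H"
  shows "(ip_norm ip (\<lambda>x. f x - g x))\<^sup>2 =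
    (ip_norm ip f)\<^sup>2 - 2 * Re (ip f g) + (ip_norm ip g)\<^sup>2"
  using norm_add_scale[OF assms, of "- 1"] by simp

lemma Cauchy_Schwarz:
  assumes "f \<in> H" "g \<in> H"
  shows "cmod (ip f g) \<le> ip_norm ip f * ip_norm ip g"
proof (cases "ip_norm ip g = 0")
  case True
  then show ?thesis using norm_eq_zero[OF assms(2)] ip_zero_right assms by simp
next
  case False
  let ?n = "(ip_norm ip g)\<^sup>2"
  define c where "c = - ip f g / complex_of_real ?n"
  have n: "?n > 0" using False by simp
  have c1: "Re (cnj c * ip f g) = - (cmod (ip f g))\<^sup>2 / ?n"
    unfolding c_def
    unfolding cmod_power2
    by (simp add: power2_eq_square add_divide_distrib diff_divide_distrib del: of_real_power)
  have c2: "(cmod c)\<^sup>2 * ?n = (cmod (ip f g))\<^sup>2 / ?n"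
    using n by (simp add: c_def norm_divide power_divide norm_power)
        (simp add: power2_eq_square power4_eq_xxxx)
  have "0 \<le> (ip_norm ip f)\<^sup>2 - (cmod (ip f g))\<^sup>2 / ?n"
    using norm_add_scale[OF assms, of c] c1 c2
    by (smt (verit, best) minus_divide_left zero_le_power2)
  then have "(cmod (ip f g))\<^sup>2 \<le> (ip_norm ip f * ip_norm ip g)\<^sup>2"
    using n by (simp add: field_simps power_mult_distrib)
  then show ?thesis
    using norm_nonneg assms by (meson mult_nonneg_nonneg power2_le_imp_le)
qed

lemma ip_tendsto:
  assumes "\<And>n. F n \<in> H" "f \<in> H" "g \<in> H" "(\<lambda>n. ip_norm ip (\<lambda>x. F n x - f x)) \<longlonglongrightarrow> 0"
  shows "(\<lambda>n. ip (F n) g) \<longlonglongrightarrow> ip f g"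
proof -
  have null: "(\<lambda>n. ip_norm ip (\<lambda>x. F n x - f x) * ip_norm ip g) \<longlonglongrightarrow> 0"
    using tendsto_mult_right[OF assms(4), of "ip_norm ip g"] by simp
  have "cmod (ip (F n) g - ip f g) \<le> ip_norm ip (\<lambda>x. F n x - f x) * ip_norm ip g" for n
    using Cauchy_Schwarz[OF diff_mem[OF assms(1,2)] assms(3), of n] ip_diff[OF assms(1,2,3), of n]
    by simp
  then have "(\<lambda>n. ip (F n) g - ip f g) \<longlonglongrightarrow> 0"
    by (intro Lim_null_comparison[OF _ null]) simp
  then show ?thesis by (simp add: LIM_zero_iff)
qed

text \<open>The Riesz representation theorem for a bounded functional given only on a subspace; the functional
  is passed as its graph \<open>G\<close>, and the bound makes it single-valued. The representer is the limit
  of a minimising sequence of \<open>\<parallel>v\<parallel>\<^sup>2 - 2 Re l\<close>. It therefore lies in the closure of the subspace,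
  and its norm is estimated by passing to the limit in \<open>\<bar>l\<bar> \<le> C \<parallel>v\<parallel>\<close>.\<close>

lemma riesz_subspace:
  fixes G :: "(('a \<Rightarrow> complex) \<times> complex) set"
  assumes zero: "(\<lambda>x. 0, 0) \<in> G"
    and lin: "\<And>v l w p c. (v, l) \<in> G \<Longrightarrow> (w, p) \<in> G \<Longrightarrow> (\<lambda>x. v x + c * w x, l + c * p) \<in> G"
    and GH: "\<And>v l. (v, l) \<in> G \<Longrightarrow> v \<in> H"
    and bounded: "\<And>v l. (v, l) \<in> G \<Longrightarrow> cmod l \<le> C * ip_norm ip v"
  shows "\<exists>g\<in>H. (ip_norm ip g)\<^sup>2 \<le> C * ip_norm ip g \<and> (\<forall>v l. (v, l) \<in> G \<longrightarrow> ip v g = l)"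
proof -
  define J where "J = (\<lambda>(v, l). (ip_norm ip v)\<^sup>2 - 2 * Re l)"
  define I where "I = Inf (J ` G)"
  have J_ge: "J p \<ge> - C\<^sup>2" if "p \<in> G" for p
  proof -
    obtain v l where p: "p = (v, l)" by (cases p)
    have "Re l \<le> C * ip_norm ip v"
      using bounded[of v l] that p complex_Re_le_cmod[of l] by simp
    moreover have "0 \<le> (ip_norm ip v - C)\<^sup>2" by simp
    ultimately show ?thesis by (simp add: J_def p power2_eq_square algebra_simps)
  qed
  have bdd: "bdd_below (J ` G)" using J_ge by (auto intro!: bdd_belowI)
  have I_le: "I \<le> J p" if "p \<in> G" for p
    unfolding I_def using bdd that by (simp add: cInf_lower)
  have "\<exists>p\<in>G. J p < I + 1 / real (Suc n)" for n
    using cInf_lessD[of "J ` G" "I + 1 / real (Suc n)"] zero unfolding I_def by auto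
  then obtain P where P: "\<And>n. P n \<in> G" "\<And>n. J (P n) < I + 1 / real (Suc n)" by metis
  define F where "F = (\<lambda>n. fst (P n))"
  define L where "L = (\<lambda>n. snd (P n))"
  have FL: "(F n, L n) \<in> G" for n using P(1) by (simp add: F_def L_def)
  have FH: "F n \<in> H" for n using GH FL by blast
  have JFL: "J (F n, L n) < I + 1 / real (Suc n)" for n using P(2) by (simp add: F_def L_def)
  \<comment> \<open>The parallelogram law: the midpoint of two near-minimisers cannot beat the infimum.\<close>
  have close: "(ip_norm ip (\<lambda>x. F m x - F n x))\<^sup>2 \<le>
      2 * (1 / real (Suc m)) + 2 * (1 / real (Suc n))" for m n
  proof -
    have "(\<lambda>x. F m x + 1 * F n x, L m + 1 * L n) \<in> G" using lin[OF FL FL] .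
    then have s: "(\<lambda>x. F m x + F n x, L m + L n) \<in> G" by simp
    have sH: "(\<lambda>x. F m x + F n x) \<in> H" using GH[OF s] .
    have "I \<le> J (\<lambda>x. 0 + (1/2) * (F m x + F n x), 0 + (1/2) * (L m + L n))"
      using I_le[OF lin[OF zero s]] .
    also have "\<dots> = (ip_norm ip (\<lambda>x. 0 + (1/2) * (F m x + F n x)))\<^sup>2 - Re (L m + L n)"
      by (simp add: J_def add_divide_distrib)
    also have "(ip_norm ip (\<lambda>x. 0 + (1/2) * (F m x + F n x)))\<^sup>2 =
        (ip_norm ip (\<lambda>x. F m x + F n x))\<^sup>2 / 4"
      unfolding norm_add_scale[OF zero_mem sH, of "1/2"]
      using ip_zero_left[OF sH] ip_self[OF zero_mem] ip_zero_left[OF zero_mem]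
      by (simp add: power_divide)
    also have "(ip_norm ip (\<lambda>x. F m x + F n x))\<^sup>2 =
        (ip_norm ip (F m))\<^sup>2 + 2 * Re (ip (F m) (F n)) + (ip_norm ip (F n))\<^sup>2"
      using norm_add_scale[OF FH FH, of m 1 n] by simp
    finally have mid: "I \<le> ((ip_norm ip (F m))\<^sup>2 + 2 * Re (ip (F m) (F n)) + (ip_norm ip (F n))\<^sup>2) / 4
        - (Re (L m) + Re (L n))" by simp
    have "I \<le> (a + 2 * r + b) / 4 - (l + k) \<Longrightarrow> a - 2 * l < I + x \<Longrightarrow> b - 2 * k < I + y \<Longrightarrow>
        a - 2 * r + b \<le> 2 * x + 2 * y" for a b r l k x y :: real
      by argo
    from this[OF mid] show ?thesis
      using JFL[of m] JFL[of n] unfolding norm_diff[OF FH FH] J_def prod.case by blast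
  qed
  have "\<exists>N. \<forall>m\<ge>N. \<forall>n\<ge>N. ip_norm ip (\<lambda>x. F m x - F n x) < e" if "e > 0" for e :: real
  proof -
    obtain N where N: "1 / real (Suc N) < e\<^sup>2 / 4"
      using reals_Archimedean[of "e\<^sup>2 / 4"] \<open>e > 0\<close> unfolding inverse_eq_divide
      by (metis divide_pos_pos zero_less_numeral zero_less_power)
    have "ip_norm ip (\<lambda>x. F m x - F n x) < e" if mn: "m \<ge> N" "n \<ge> N" for m n
    proof -
      have "1 / real (Suc m) \<le> 1 / real (Suc N)" "1 / real (Suc n) \<le> 1 / real (Suc N)"
        using mn by (auto simp: field_simps)
      then have "(ip_norm ip (\<lambda>x. F m x - F n x))\<^sup>2 < e\<^sup>2"
        using close[of m n] N by argo
      then show ?thesis using \<open>e > 0\<close> by (simp add: power2_less_imp_less)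
    qed
    then show ?thesis by blast
  qed
  then obtain g where g: "g \<in> H" and lim: "(\<lambda>n. ip_norm ip (\<lambda>x. F n x - g x)) \<longlonglongrightarrow> 0"
    using complete[of F] FH by blast
  have rep: "ip w g = p" if wp: "(w, p) \<in> G" for w p
  proof -
    have w: "w \<in> H" using GH wp .
    \<comment> \<open>First variation of \<open>J\<close> at the minimiser in the direction \<open>w\<close>.\<close>
    have var: "0 \<le> 2 * Re (cnj c * ip g w) - 2 * Re (c * p) + (cmod c)\<^sup>2 * (ip_norm ip w)\<^sup>2" for c
    proof -
      have "0 \<le> 1 / real (Suc n) + (2 * Re (cnj c * ip (F n) w) - 2 * Re (c * p) +
          (cmod c)\<^sup>2 * (ip_norm ip w)\<^sup>2)" for n
        using I_le[OF lin[OF FL wp, of n c]] JFL[of n] norm_add_scale[OF FH w, of n c]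
        by (simp add: J_def)
      moreover have "(\<lambda>n. 1 / real (Suc n) + (2 * Re (cnj c * ip (F n) w) - 2 * Re (c * p) +
          (cmod c)\<^sup>2 * (ip_norm ip w)\<^sup>2)) \<longlonglongrightarrow>
          0 + (2 * Re (cnj c * ip g w) - 2 * Re (c * p) + (cmod c)\<^sup>2 * (ip_norm ip w)\<^sup>2)"
        by (intro tendsto_intros ip_tendsto[OF FH g w lim] LIMSEQ_Suc[OF lim_1_over_n])
      ultimately show ?thesis
        by (metis (no_types, lifting) LIMSEQ_le_const add.left_neutral)
    qed
    define z where "z = ip g w - cnj p"
    \<comment> \<open>A step small enough that the linear term of the variation beats the quadratic one.\<close>
    define s where "s = 1 / (1 + (ip_norm ip w)\<^sup>2)"
    have s: "s > 0" "s * (ip_norm ip w)\<^sup>2 < 1"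
      using zero_le_power2[of "ip_norm ip w"] by (auto simp: s_def field_simps add_pos_nonneg)
    define c where "c = - complex_of_real s * z"
    have "Re (cnj c * ip g w) - Re (c * p) = Re (cnj c * ip g w) - Re (cnj (c * p))" by simp
    also have "\<dots> = Re (cnj c * z)" by (simp add: z_def algebra_simps)
    also have "\<dots> = - s * (cmod z)\<^sup>2"
      unfolding c_def cmod_power2 by (simp add: power2_eq_square algebra_simps)
    finally have "0 \<le> - 2 * (s * (cmod z)\<^sup>2) + s\<^sup>2 * (cmod z)\<^sup>2 * (ip_norm ip w)\<^sup>2"
      using var[of c] s(1) by (simp add: c_def norm_mult power_mult_distrib)
    also have "\<dots> = (s * (cmod z)\<^sup>2) * (s * (ip_norm ip w)\<^sup>2 - 2)"
      by (simp add: power2_eq_square algebra_simps)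
    finally have "s * (cmod z)\<^sup>2 = 0"
      using s by (smt (verit, best) mult_pos_neg mult_nonneg_nonneg zero_le_power2)
    then have "z = 0" using s by simp
    then show ?thesis using ip_commute[OF g w] by (simp add: z_def)
  qed
  have lim_L: "(\<lambda>n. Re (L n)) \<longlonglongrightarrow> (ip_norm ip g)\<^sup>2"
    using tendsto_Re[OF ip_tendsto[OF FH g g lim]] rep[OF FL] ip_self[OF g] by simp
  have "(\<lambda>n. (ip_norm ip (\<lambda>x. F n x - g x))\<^sup>2 + 2 * Re (L n) - (ip_norm ip g)\<^sup>2) \<longlonglongrightarrow>
      0\<^sup>2 + 2 * (ip_norm ip g)\<^sup>2 - (ip_norm ip g)\<^sup>2"
    by (intro tendsto_intros lim lim_L)
  moreover have "(ip_norm ip (\<lambda>x. F n x - g x))\<^sup>2 + 2 * Re (L n) - (ip_norm ip g)\<^sup>2 =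
      (ip_norm ip (F n))\<^sup>2" for n
    using norm_diff[OF FH g, of n] rep[OF FL, of n] by simp
  ultimately have "(\<lambda>n. (ip_norm ip (F n))\<^sup>2) \<longlonglongrightarrow> (ip_norm ip g)\<^sup>2" by simp
  from tendsto_real_sqrt[OF this] have "(\<lambda>n. ip_norm ip (F n)) \<longlonglongrightarrow> ip_norm ip g"
    using norm_nonneg FH g by simp
  then have "(\<lambda>n. C * ip_norm ip (F n)) \<longlonglongrightarrow> C * ip_norm ip g" by (intro tendsto_intros)
  moreover have "Re (L n) \<le> C * ip_norm ip (F n)" for n
    using bounded[OF FL, of n] complex_Re_le_cmod[of "L n"] by linarith
  ultimately have "(ip_norm ip g)\<^sup>2 \<le> C * ip_norm ip g"
    using lim_L by (meson LIMSEQ_le)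
  with g rep show ?thesis by blast
qed

end

section \<open>Orthonormal bases from kernel expansions\<close>

context function_hilbert_space
begin

lemma norm_diff_commute:
  assumes "f \<in> H" "g \<in> H"
  shows "ip_norm ip (\<lambda>x. f x - g x) = ip_norm ip (\<lambda>x. g x - f x)"
proof -
  have "(ip_norm ip (\<lambda>x. f x - g x))\<^sup>2 = (ip_norm ip (\<lambda>x. g x - f x))\<^sup>2"
    unfolding norm_diff[OF assms] norm_diff[OF assms(2,1)] ip_commute[OF assms] by simp
  then show ?thesis
    using norm_nonneg[OF diff_mem] assms by (metis power2_eq_imp_eq)
qed

lemma norm_orthonormal_comb:
  assumes "finite S" "\<And>i. i \<in> S \<Longrightarrow> e i \<in> H"
    and orth: "\<And>i j. i \<in> S \<Longrightarrow> j \<in> S \<Longrightarrow> ip (e i) (e j) = (if i = j then 1 else 0)"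
  shows "(ip_norm ip (\<lambda>x. \<Sum>i\<in>S. c i * e i x))\<^sup>2 = (\<Sum>i\<in>S. (cmod (c i))\<^sup>2)"
proof -
  let ?f = "\<lambda>x. \<Sum>i\<in>S. c i * e i x"
  have f: "?f \<in> H" using comb_mem assms(2) .
  have "ip ?f ?f = (\<Sum>i\<in>S. c i * ip (e i) ?f)"
    using ip_comb[of S e ?f c] assms(2) f by simp
  also have "\<dots> = (\<Sum>i\<in>S. c i * (\<Sum>j\<in>S. cnj (c j) * ip (e i) (e j)))"
    using ip_comb_right[of S e _ c] assms(2) by simp
  also have "\<dots> = (\<Sum>i\<in>S. c i * cnj (c i))"
    using assms(1) by (intro sum.cong refl) (simp add: orth if_distrib sum.delta cong: if_cong)
  also have "\<dots> = complex_of_real (\<Sum>i\<in>S. (cmod (c i))\<^sup>2)"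
    by (simp only: complex_norm_square of_real_sum)
  finally show ?thesis
    unfolding ip_self[OF f] of_real_eq_iff .
qed

text \<open>For density it is enough that no nonzero element is orthogonal to the family: by Bessel's
  inequality the Fourier partial sums of \<open>f\<close> are Cauchy, and the difference of \<open>f\<close> and their limit is
  orthogonal to every member, hence zero.\<close>

lemma orthonormal_basisI:
  fixes e :: "'i::countable \<Rightarrow> 'a \<Rightarrow> complex"
  assumes mem: "\<And>i. e i \<in> H"
    and orth: "\<And>i j. ip (e i) (e j) = (if i = j then 1 else 0)"
    and total: "\<And>f. f \<in> H \<Longrightarrow> (\<And>i. ip f (e i) = 0) \<Longrightarrow> f = (\<lambda>x. 0)"
  shows "orthonormal_basis H ip e"
  unfolding orthonormal_basis_def
proof (intro conjI allI ballI impI)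
  fix f and \<epsilon> :: real
  assume f: "f \<in> H" and \<epsilon>: "\<epsilon> > 0"
  define a where "a i = ip f (e i)" for i
  define S where "S n = {i::'i. to_nat i < n}" for n
  define F where "F n x = (\<Sum>i\<in>S n. a i * e i x)" for n x
  define r where "r n = (\<Sum>i\<in>S n. (cmod (a i))\<^sup>2)" for n
  have fin: "finite (S n)" for n
    unfolding S_def using finite_vimageI[OF finite_lessThan[of n] inj_to_nat]
    by (simp add: vimage_def)
  have S_mono: "S m \<subseteq> S n" if "m \<le> n" for m n using that by (auto simp: S_def)
  have FH: "F n \<in> H" for n
    using comb_mem[of "S n" e a] mem by (simp add: F_def[abs_def])
  have r_le: "r n \<le> (ip_norm ip f)\<^sup>2" for n
  proof -
    have "ip f (F n) = (\<Sum>i\<in>S n. cnj (a i) * a i)"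
      using ip_comb_right[of "S n" e f a] mem f by (simp add: F_def[abs_def] a_def)
    also have "\<dots> = complex_of_real (r n)"
      by (simp only: r_def complex_norm_square of_real_sum mult.commute)
    finally have "(ip_norm ip (\<lambda>x. f x - F n x))\<^sup>2 = (ip_norm ip f)\<^sup>2 - 2 * r n + (ip_norm ip (F n))\<^sup>2"
      using norm_diff[OF f FH, of n] by simp
    moreover have "(ip_norm ip (F n))\<^sup>2 = r n"
      unfolding F_def[abs_def] r_def using norm_orthonormal_comb[OF fin mem orth] .
    ultimately show ?thesis using zero_le_power2[of "ip_norm ip (\<lambda>x. f x - F n x)"] by linarith
  qed
  have r_diff: "(ip_norm ip (\<lambda>x. F n x - F m x))\<^sup>2 = r n - r m" if "m \<le> n" for m n
  proof -
    have "F n x - F m x = (\<Sum>i\<in>S n - S m. a i * e i x)" for x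
      using sum_diff[OF fin[of n] S_mono[OF that], of "\<lambda>i. a i * e i x"] by (simp add: F_def)
    moreover have "r n - r m = (\<Sum>i\<in>S n - S m. (cmod (a i))\<^sup>2)"
      using sum_diff[OF fin[of n] S_mono[OF that], of "\<lambda>i. (cmod (a i))\<^sup>2"] by (simp add: r_def)
    ultimately show ?thesis using norm_orthonormal_comb[OF _ mem orth, of "S n - S m" a] fin by simp
  qed
  have "incseq r"
    unfolding incseq_def r_def using fin S_mono by (intro allI impI sum_mono2) auto
  then have "Cauchy r"
    using r_le by (metis incseq_convergent LIMSEQ_imp_Cauchy)
  have "\<exists>N. \<forall>m\<ge>N. \<forall>n\<ge>N. ip_norm ip (\<lambda>x. F m x - F n x) < \<delta>" if "\<delta> > 0" for \<delta> :: real
  proof -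
    obtain N where N: "\<And>m n. m \<ge> N \<Longrightarrow> n \<ge> N \<Longrightarrow> \<bar>r m - r n\<bar> < \<delta>\<^sup>2"
      using \<open>Cauchy r\<close> \<open>\<delta> > 0\<close> unfolding Cauchy_def dist_real_def by (metis zero_less_power)
    have ordered: "ip_norm ip (\<lambda>x. F n x - F m x) < \<delta>" if "N \<le> m" "m \<le> n" for m n
      using r_diff[OF that(2)] N[of n m] that \<open>\<delta> > 0\<close>
      by (intro power2_less_imp_less[of _ \<delta>]) auto
    have "ip_norm ip (\<lambda>x. F m x - F n x) < \<delta>" if "N \<le> m" "N \<le> n" for m n
      using ordered[of m n] ordered[of n m] that norm_diff_commute[OF FH FH, of m n]
      by (cases "m \<le> n") auto
    then show ?thesis by blast
  qed
  then obtain g where g: "g \<in> H" and lim: "(\<lambda>n. ip_norm ip (\<lambda>x. F n x - g x)) \<longlonglongrightarrow> 0"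
    using complete[of F] FH by blast
  have "ip g (e i) = a i" for i
  proof -
    have "ip (F n) (e i) = a i" if "n > to_nat i" for n
    proof -
      have "ip (F n) (e i) = (\<Sum>j\<in>S n. a j * ip (e j) (e i))"
        using ip_comb[of "S n" e "e i" a] mem by (simp add: F_def[abs_def])
      also have "\<dots> = a i"
        using that fin[of n] by (simp add: orth if_distrib S_def sum.delta cong: if_cong)
      finally show ?thesis .
    qed
    then have "(\<lambda>n. ip (F n) (e i)) \<longlonglongrightarrow> a i"
      by (intro tendsto_eventually eventually_mono[OF eventually_gt_at_top[of "to_nat i"]])
    with ip_tendsto[OF FH g mem lim] show ?thesis using LIMSEQ_unique by blast
  qed
  then have "(\<lambda>x. f x - g x) = (\<lambda>x. 0)"
    using total[OF diff_mem[OF f g]] ip_diff[OF f g mem] by (simp add: a_def)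
  then have "f = g" by (simp add: fun_eq_iff)
  then obtain n where "ip_norm ip (\<lambda>x. F n x - f x) < \<epsilon>"
    using order_tendstoD(2)[OF lim \<epsilon>] eventually_sequentially by auto
  then have "ip_norm ip (\<lambda>x. f x - (\<Sum>i\<in>S n. a i * e i x)) < \<epsilon>"
    using norm_diff_commute[OF FH f] by (simp add: F_def)
  then show "\<exists>S c. finite S \<and> ip_norm ip (\<lambda>x. f x - (\<Sum>i\<in>S. c i * e i x)) < \<epsilon>"
    using fin by blast
qed (use mem orth in auto)

end

text \<open>This excludes nontrivial relations with square-summable coefficients, which is more than
  excluding finite ones. Together with a kernel expansion it is what makes a family orthonormal.\<close>

definition l2_independent :: "('i \<Rightarrow> 'a \<Rightarrow> complex) \<Rightarrow> bool"
  where "l2_independent e \<longleftrightarrow> (\<forall>a. (\<lambda>i. (cmod (a i))\<^sup>2) summable_on UNIV \<longrightarrow>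
    (\<forall>t. ((\<lambda>i. a i * e i t) has_sum 0) UNIV) \<longrightarrow> (\<forall>i. a i = 0))"

text \<open>The pairs \<open>(v, a)\<close> form the graph of the isometry from the span of the kernel functions into
  \<open>\<ell>\<^sup>2\<close> that sends \<open>K t\<close> to the sequence of all \<open>cnj (e i t)\<close>. Generating the graph by single steps turns
  the isometry property into an induction and avoids double sums over the points \<open>t\<close>.\<close>

inductive kernel_comb ::
  "('a \<Rightarrow> 'a \<Rightarrow> complex) \<Rightarrow> ('i \<Rightarrow> 'a \<Rightarrow> complex) \<Rightarrow> ('a \<Rightarrow> complex) \<Rightarrow> ('i \<Rightarrow> complex) \<Rightarrow> bool"
  for K e where
  zero: "kernel_comb K e (\<lambda>u. 0) (\<lambda>i. 0)"
| step: "kernel_comb K e v a \<Longrightarrow>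
    kernel_comb K e (\<lambda>u. v u + c * K t u) (\<lambda>i. a i + c * cnj (e i t))"

lemma kernel_comb_add_scale:
  assumes "kernel_comb K e w b" "kernel_comb K e v a"
  shows "kernel_comb K e (\<lambda>u. v u + c * w u) (\<lambda>i. a i + c * b i)"
  using assms(1)
proof induction
  case zero
  then show ?case using assms(2) by simp
next
  case (step w b d t)
  then show ?case using kernel_comb.step[OF step(2), of "c * d" t] by (simp add: algebra_simps)
qed

locale rkhs_expansion = rkhs K H ip
  for K :: "'a \<Rightarrow> 'a \<Rightarrow> complex" and H ip +
  fixes e :: "'i \<Rightarrow> 'a \<Rightarrow> complex"
  assumes expansion: "\<And>t u. ((\<lambda>i. cnj (e i t) * e i u) has_sum K t u) UNIV"
begin

lemma kernel_comb_mem: "kernel_comb K e v a \<Longrightarrow> v \<in> H"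
  by (induction rule: kernel_comb.induct)
    (use zero_mem add_mem[OF _ scale_mem[OF kernel_mem]] in auto)

lemma kernel_comb_value:
  "kernel_comb K e v a \<Longrightarrow> ((\<lambda>i. a i * e i u) has_sum v u) UNIV"
proof (induction rule: kernel_comb.induct)
  case (step v a c t)
  show ?case
    using has_sum_add[OF step(2) has_sum_cmult_right[OF expansion[of t u], of c]]
    by (simp add: algebra_simps)
qed simp

lemma norm_kernel: "complex_of_real ((ip_norm ip (K t))\<^sup>2) = K t t"
  using ip_self[OF kernel_mem] reproducing[OF kernel_mem] by metis

lemma expansion_diag: "((\<lambda>i. (cmod (e i t))\<^sup>2) has_sum (ip_norm ip (K t))\<^sup>2) UNIV"
proof -
  have "Re (cnj (e i t) * e i t) = (cmod (e i t))\<^sup>2" for i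
    unfolding cmod_power2 by (simp add: power2_eq_square)
  then show ?thesis
    using has_sum_Re[OF expansion[of t t]] norm_kernel[of t] by (metis (no_types, lifting) Re_complex_of_real has_sum_cong)
qed

text \<open>The isometry property. Expanding the square of \<open>a i + c * cnj (e i t)\<close>, the cross terms sum to
  \<open>2 * Re (cnj c * v t)\<close> by \<open>kernel_comb_value\<close>, which is the cross term
  in \<open>\<parallel>v + c K t\<parallel>\<^sup>2\<close> by the reproducing property.\<close>

lemma kernel_comb_norm:
  "kernel_comb K e v a \<Longrightarrow> ((\<lambda>i. (cmod (a i))\<^sup>2) has_sum (ip_norm ip v)\<^sup>2) UNIV"
proof (induction rule: kernel_comb.induct)
  case zero
  have "(ip_norm ip (\<lambda>u. 0))\<^sup>2 = 0" using ip_self[OF zero_mem] ip_zero_left[OF zero_mem] by simp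
  then show ?case by simp
next
  case (step v a c t)
  have v: "v \<in> H" using kernel_comb_mem step(1) .
  have "(cmod (a i + c * cnj (e i t)))\<^sup>2 =
      (cmod (a i))\<^sup>2 + 2 * Re (cnj c * (a i * e i t)) + (cmod c)\<^sup>2 * (cmod (e i t))\<^sup>2" for i
    unfolding cmod_power2 by (simp add: power2_eq_square algebra_simps)
  moreover have "((\<lambda>i. (cmod (a i))\<^sup>2 + 2 * Re (cnj c * (a i * e i t)) + (cmod c)\<^sup>2 * (cmod (e i t))\<^sup>2)
      has_sum ((ip_norm ip v)\<^sup>2 + 2 * Re (cnj c * v t) + (cmod c)\<^sup>2 * (ip_norm ip (K t))\<^sup>2)) UNIV"
    by (intro has_sum_add step(2) has_sum_cmult_right has_sum_Re kernel_comb_value[OF step(1)]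
        expansion_diag)
  ultimately show ?case
    unfolding norm_add_scale[OF v kernel_mem] reproducing[OF v] by simp
qed

text \<open>This is where membership of the \<open>e i\<close> in the abstract space \<open>H\<close> comes from. On the span of the
  kernel functions, \<open>K t \<mapsto> cnj (\<Sum>i\<in>S. c i * e i t)\<close> extends to a functional which, through the
  isometry, is the \<open>\<ell>\<^sup>2\<close> inner product with \<open>c\<close>; hence it is bounded by the norm of \<open>c\<close>, and its
  Riesz representer takes the value \<open>\<Sum>i\<in>S. c i * e i t\<close> at \<open>t\<close>.\<close>

lemma finite_comb:
  assumes S: "finite S"
  shows "(\<lambda>t. \<Sum>i\<in>S. c i * e i t) \<in> H"
    and "(ip_norm ip (\<lambda>t. \<Sum>i\<in>S. c i * e i t))\<^sup>2 \<le> (\<Sum>i\<in>S. (cmod (c i))\<^sup>2)"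
proof -
  define C where "C = L2_set (\<lambda>i. cmod (c i)) S"
  define l where "l a = (\<Sum>i\<in>S. a i * cnj (c i))" for a
  define G where "G = {(v, l a) | v a. kernel_comb K e v a}"
  have zero_G: "(\<lambda>u. 0, 0) \<in> G"
    unfolding G_def l_def using kernel_comb.zero[of K e] by force
  have lin_G: "(\<lambda>x. v x + d * w x, p + d * q) \<in> G" if G: "(v, p) \<in> G" "(w, q) \<in> G" for v p w q d
  proof -
    obtain a b where "kernel_comb K e v a" "p = l a" "kernel_comb K e w b" "q = l b"
      using G by (auto simp: G_def)
    moreover have "l a + d * l b = l (\<lambda>i. a i + d * b i)"
      by (simp add: l_def sum_distrib_left sum.distrib algebra_simps)
    ultimately show ?thesis
      using kernel_comb_add_scale[of K e w b v a d] by (auto simp: G_def)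
  qed
  have G_H: "v \<in> H" if "(v, p) \<in> G" for v p
    using that kernel_comb_mem by (auto simp: G_def)
  have G_bound: "cmod p \<le> C * ip_norm ip v" if vp: "(v, p) \<in> G" for v p
  proof -
    obtain a where a: "kernel_comb K e v a" and p: "p = l a"
      using vp by (auto simp: G_def)
    have "cmod p \<le> (\<Sum>i\<in>S. \<bar>cmod (a i)\<bar> * \<bar>cmod (c i)\<bar>)"
      unfolding p l_def by (rule order_trans[OF norm_sum]) (simp add: norm_mult)
    also have "\<dots> \<le> L2_set (\<lambda>i. cmod (a i)) S * C"
      unfolding C_def by (rule L2_set_mult_ineq)
    also have "L2_set (\<lambda>i. cmod (a i)) S \<le> ip_norm ip v"
      unfolding L2_set_def
      using finite_sum_le_has_sum[OF kernel_comb_norm[OF a] S] norm_nonneg[OF kernel_comb_mem[OF a]]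
      by (intro real_le_lsqrt) auto
    finally show ?thesis
      by (simp add: C_def L2_set_nonneg mult.commute mult_right_mono)
  qed
  have "\<exists>g\<in>H. (ip_norm ip g)\<^sup>2 \<le> C * ip_norm ip g \<and> (\<forall>v p. (v, p) \<in> G \<longrightarrow> ip v g = p)"
    by (rule riesz_subspace[OF zero_G]) (fact lin_G G_H G_bound)+
  then obtain g where g: "g \<in> H" "(ip_norm ip g)\<^sup>2 \<le> C * ip_norm ip g"
    and rep: "\<And>v p. (v, p) \<in> G \<Longrightarrow> ip v g = p"
    by blast
  have "g t = (\<Sum>i\<in>S. c i * e i t)" for t
  proof -
    have "kernel_comb K e (K t) (\<lambda>i. cnj (e i t))"
      using kernel_comb.step[OF kernel_comb.zero, of K e 1 t] by simp
    then have "ip (K t) g = l (\<lambda>i. cnj (e i t))" using rep by (auto simp: G_def)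
    then show ?thesis
      using reproducing[OF g(1), of t] ip_commute[OF kernel_mem g(1), of t]
      by (simp add: l_def mult.commute)
  qed
  then have eq: "g = (\<lambda>t. \<Sum>i\<in>S. c i * e i t)" ..
  have "ip_norm ip g \<le> C"
    using g norm_nonneg[OF g(1)] by (cases "ip_norm ip g = 0")
      (auto simp: C_def L2_set_nonneg power2_eq_square)
  then have "(ip_norm ip g)\<^sup>2 \<le> C\<^sup>2" using norm_nonneg[OF g(1)] by (rule power_mono)
  also have "C\<^sup>2 = (\<Sum>i\<in>S. (cmod (c i))\<^sup>2)" by (simp add: C_def L2_set_def sum_nonneg)
  finally show "(\<lambda>t. \<Sum>i\<in>S. c i * e i t) \<in> H"
    "(ip_norm ip (\<lambda>t. \<Sum>i\<in>S. c i * e i t))\<^sup>2 \<le> (\<Sum>i\<in>S. (cmod (c i))\<^sup>2)"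
    using g eq by simp_all
qed

lemma mem: "e i \<in> H"
  using finite_comb(1)[of "{i}" "\<lambda>_. 1"] by simp

text \<open>The inequality holds before orthonormality is known: it is dual to the norm bound
  on finite combinations.\<close>

lemma bessel:
  assumes h: "h \<in> H" and S: "finite S"
  shows "(\<Sum>i\<in>S. (cmod (ip h (e i)))\<^sup>2) \<le> (ip_norm ip h)\<^sup>2"
proof -
  define x where "x = (\<Sum>i\<in>S. (cmod (ip h (e i)))\<^sup>2)"
  let ?f = "\<lambda>t. \<Sum>i\<in>S. ip h (e i) * e i t"
  have "ip h ?f = (\<Sum>i\<in>S. cnj (ip h (e i)) * ip h (e i))"
    using ip_comb_right[of S e h] mem h by simp
  also have "\<dots> = complex_of_real x"
    by (simp only: x_def complex_norm_square of_real_sum mult.commute)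
  finally have eq: "ip h ?f = complex_of_real x" .
  have "\<bar>x\<bar> \<le> ip_norm ip h * ip_norm ip ?f"
    using Cauchy_Schwarz[OF h finite_comb(1)[OF S, of "\<lambda>i. ip h (e i)"]]
    unfolding eq norm_of_real .
  then have "x\<^sup>2 \<le> (ip_norm ip h * ip_norm ip ?f)\<^sup>2"
    by (metis abs_ge_zero power2_abs power_mono)
  also have "\<dots> \<le> (ip_norm ip h)\<^sup>2 * x"
    unfolding power_mult_distrib x_def by (intro mult_left_mono finite_comb S) simp
  finally have "x * x \<le> (ip_norm ip h)\<^sup>2 * x" by (simp add: power2_eq_square)
  moreover have "x \<ge> 0" by (simp add: x_def sum_nonneg)
  ultimately show ?thesis
    unfolding x_def[symmetric] by (cases "x = 0") (auto simp: mult_le_cancel_right)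
qed

lemma summable_coefficients:
  assumes "h \<in> H"
  shows "(\<lambda>i. (cmod (ip h (e i)))\<^sup>2) summable_on UNIV"
  using bessel[OF assms] by (intro nonneg_bdd_above_summable_on bdd_aboveI) auto

text \<open>The sums \<open>q = (\<Sum>i\<in>S. cnj (e i t) * e i)\<close> converge to \<open>K t\<close> in norm, because
  \<open>\<parallel>K t - q\<parallel>\<^sup>2 \<le> K t t - (\<Sum>i\<in>S. \<bar>e i t\<bar>\<^sup>2)\<close>; pairing \<open>h\<close> with them gives the expansion of \<open>h t\<close>.\<close>

lemma value_expansion:
  assumes h: "h \<in> H"
  shows "((\<lambda>i. ip h (e i) * e i t) has_sum h t) UNIV"
proof -
  have bound: "norm ((\<Sum>i\<in>S. ip h (e i) * e i t) - h t) \<le>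
      sqrt ((ip_norm ip (K t))\<^sup>2 - (\<Sum>i\<in>S. (cmod (e i t))\<^sup>2)) * ip_norm ip h" if S: "finite S" for S
  proof -
    let ?q = "\<lambda>u. \<Sum>i\<in>S. cnj (e i t) * e i u"
    have q: "?q \<in> H" using finite_comb(1)[OF S] .
    have qt: "?q t = complex_of_real (\<Sum>i\<in>S. (cmod (e i t))\<^sup>2)"
      by (simp only: complex_norm_square of_real_sum mult.commute)
    have "ip (K t) ?q = cnj (?q t)"
      using ip_commute[OF q kernel_mem, of t] by (simp only: reproducing[OF q])
    then have "(ip_norm ip (\<lambda>u. K t u - ?q u))\<^sup>2 \<le> (ip_norm ip (K t))\<^sup>2 - (\<Sum>i\<in>S. (cmod (e i t))\<^sup>2)"
      using norm_diff[OF kernel_mem q, of t] finite_comb(2)[OF S, of "\<lambda>i. cnj (e i t)"]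
      unfolding qt by simp
    then have le: "ip_norm ip (\<lambda>u. K t u - ?q u) \<le> sqrt ((ip_norm ip (K t))\<^sup>2 - (\<Sum>i\<in>S. (cmod (e i t))\<^sup>2))"
      by (rule real_le_rsqrt)
    have "ip h ?q = (\<Sum>i\<in>S. ip h (e i) * e i t)"
      using ip_comb_right[of S e h "\<lambda>i. cnj (e i t)"] mem h by (simp add: mult.commute)
    then have "cnj (ip (\<lambda>u. K t u - ?q u) h) = h t - (\<Sum>i\<in>S. ip h (e i) * e i t)"
      unfolding ip_diff[OF kernel_mem q h]
      using ip_commute[OF kernel_mem h] ip_commute[OF q h] reproducing[OF h] by simp
    from arg_cong[OF this, of cmod]
    have "norm ((\<Sum>i\<in>S. ip h (e i) * e i t) - h t) = cmod (ip (\<lambda>u. K t u - ?q u) h)"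
      unfolding complex_mod_cnj norm_minus_commute[of "h t"] by (rule sym)
    also have "\<dots> \<le> ip_norm ip (\<lambda>u. K t u - ?q u) * ip_norm ip h"
      using Cauchy_Schwarz[OF diff_mem[OF kernel_mem q] h] .
    also have "\<dots> \<le> sqrt ((ip_norm ip (K t))\<^sup>2 - (\<Sum>i\<in>S. (cmod (e i t))\<^sup>2)) * ip_norm ip h"
      using le norm_nonneg[OF h] by (rule mult_right_mono)
    finally show ?thesis .
  qed
  have "((\<lambda>S. sqrt ((ip_norm ip (K t))\<^sup>2 - (\<Sum>i\<in>S. (cmod (e i t))\<^sup>2)) * ip_norm ip h) \<longlongrightarrow>
      sqrt ((ip_norm ip (K t))\<^sup>2 - (ip_norm ip (K t))\<^sup>2) * ip_norm ip h) (finite_subsets_at_top UNIV)"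
    using expansion_diag[of t] unfolding has_sum_def by (intro tendsto_intros)
  then have null: "((\<lambda>S. sqrt ((ip_norm ip (K t))\<^sup>2 - (\<Sum>i\<in>S. (cmod (e i t))\<^sup>2)) * ip_norm ip h)
      \<longlongrightarrow> 0) (finite_subsets_at_top UNIV)" by simp
  have "((\<lambda>S. (\<Sum>i\<in>S. ip h (e i) * e i t) - h t) \<longlongrightarrow> 0) (finite_subsets_at_top UNIV)"
    by (rule Lim_null_comparison[OF _ null])
      (use bound in \<open>auto intro: eventually_finite_subsets_at_top_weakI\<close>)
  then show ?thesis unfolding has_sum_def by (simp add: LIM_zero_iff)
qed

text \<open>Expanding \<open>e k\<close> itself gives \<open>e k = (\<Sum>i. \<langle>e k, e i\<rangle> e i)\<close> pointwise with coefficients that are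
  square summable by Bessel. Comparison with the trivial expansion forces \<open>\<langle>e k, e i\<rangle>\<close>
  to be the Kronecker delta.\<close>

lemma orthonormal:
  assumes "l2_independent e"
  shows "ip (e k) (e i) = (if k = i then 1 else 0)"
proof -
  define \<delta> :: "'i \<Rightarrow> complex" where "\<delta> i = (if i = k then 1 else 0)" for i
  define a where "a i = ip (e k) (e i) - \<delta> i" for i
  have finite_support: "((\<lambda>i. if i = k then z i else 0) has_sum z k) UNIV"
    for z :: "'i \<Rightarrow> 'b::{comm_monoid_add,topological_space}"
    by (rule has_sum_finite_neutralI[of "{k}"]) auto
  have "(cmod (a i))\<^sup>2 = (cmod (ip (e k) (e i)))\<^sup>2 +
      (if i = k then (cmod (ip (e k) (e i) - 1))\<^sup>2 - (cmod (ip (e k) (e i)))\<^sup>2 else 0)" for i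
    by (simp add: a_def \<delta>_def)
  moreover have "(\<lambda>i. (cmod (ip (e k) (e i)))\<^sup>2 +
      (if i = k then (cmod (ip (e k) (e i) - 1))\<^sup>2 - (cmod (ip (e k) (e i)))\<^sup>2 else 0)) summable_on UNIV"
    by (intro summable_on_add summable_coefficients mem has_sum_imp_summable[OF finite_support])
  ultimately have "(\<lambda>i. (cmod (a i))\<^sup>2) summable_on UNIV" by simp
  moreover have "((\<lambda>i. a i * e i t) has_sum 0) UNIV" for t
  proof -
    have "((\<lambda>i. \<delta> i * e i t) has_sum e k t) UNIV"
      using finite_support[of "\<lambda>i. e i t"] by (rule has_sum_cong[THEN iffD1, rotated]) (simp add: \<delta>_def)
    from has_sum_add[OF value_expansion[OF mem, of k t] has_sum_cmult_right[OF this, of "- 1"]] show ?thesis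
      by (simp add: a_def algebra_simps)
  qed
  ultimately have "a i = 0" using assms unfolding l2_independent_def by blast
  then show ?thesis by (auto simp: a_def \<delta>_def)
qed

end

theorem rkhs_expansion_orthonormal_basis:
  fixes e :: "'i::countable \<Rightarrow> 'a \<Rightarrow> complex"
  assumes "rkhs K H ip"
    and "\<And>t u. ((\<lambda>i. cnj (e i t) * e i u) has_sum K t u) UNIV"
    and "l2_independent e"
  shows "orthonormal_basis H ip e"
    and "\<And>f. f \<in> H \<Longrightarrow> (\<And>i. ip f (e i) = 0) \<Longrightarrow> f = (\<lambda>t. 0)"
proof -
  interpret rkhs K H ip by fact
  interpret rkhs_expansion K H ip e by unfold_locales fact
  show total: "f = (\<lambda>t. 0)" if "f \<in> H" "\<And>i. ip f (e i) = 0" for f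
  proof
    fix t
    have "((\<lambda>i::'i. 0) has_sum f t) UNIV" using value_expansion[OF that(1), of t] that(2) by simp
    then show "f t = 0" using has_sum_unique[OF _ has_sum_0_simp] by blast
  qed
  have orth: "ip (e k) (e i) = (if k = i then 1 else 0)" for k i
    using assms(3) by (rule orthonormal)
  show "orthonormal_basis H ip e"
    by (rule orthonormal_basisI[OF mem orth]) (rule total)
qed

section \<open>Uniqueness of the coefficients\<close>

text \<open>Up to the factor \<open>- 1 / sqrt 2\<close>, the series \<open>\<Sum>m. a m * psi m\<close> over \<open>m \<ge> 0\<close>, continued from the imaginary axis
  \<open>z = \<i> t\<close> to the half-plane \<open>Re z < 1/2\<close>, which \<open>z \<mapsto> z / (z - 1)\<close> maps onto the open unit disc.\<close>

definition half_series :: "(nat \<Rightarrow> complex) \<Rightarrow> complex \<Rightarrow> complex"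
  where "half_series a z = (\<Sum>m. a m * (z / (z - 1)) ^ m) / (z - 1)"

lemma one_minus_norm_moebius:
  assumes "Re z < 1/2"
  shows "1 - (cmod (z / (z - 1)))\<^sup>2 = (1 - 2 * Re z) / (cmod (z - 1))\<^sup>2"
proof -
  have "z \<noteq> 1" using assms by auto
  then have "1 - (cmod (z / (z - 1)))\<^sup>2 = ((cmod (z - 1))\<^sup>2 - (cmod z)\<^sup>2) / (cmod (z - 1))\<^sup>2"
    by (simp add: norm_divide power_divide diff_divide_distrib)
  also have "(cmod (z - 1))\<^sup>2 - (cmod z)\<^sup>2 = 1 - 2 * Re z"
    unfolding cmod_power2 by (simp add: power2_eq_square algebra_simps)
  finally show ?thesis .
qed

lemma norm_moebius:
  assumes "Re z < 1/2"
  shows "cmod (z / (z - 1)) < 1"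
proof -
  have "z \<noteq> 1" using assms by auto
  then have "0 < (1 - 2 * Re z) / (cmod (z - 1))\<^sup>2"
    using assms by (intro divide_pos_pos) auto
  then have "(cmod (z / (z - 1)))\<^sup>2 < 1\<^sup>2" using one_minus_norm_moebius[OF assms] by simp
  then show ?thesis by (rule power2_less_imp_less) simp
qed

lemma summable_square_powser:
  fixes a :: "nat \<Rightarrow> complex"
  assumes "summable (\<lambda>m. (cmod (a m))\<^sup>2)" "cmod w < 1"
  shows "summable (\<lambda>m. a m * w ^ m)"
proof (rule summable_comparison_test')
  have "(cmod w)\<^sup>2 < 1" using assms(2) by (simp add: power_less_one_iff abs_square_less_1)
  then show "summable (\<lambda>m. (cmod (a m))\<^sup>2 + ((cmod w)\<^sup>2) ^ m)"
    by (intro summable_add assms(1) summable_geometric) simp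
  fix m :: nat
  have "2 * (cmod (a m) * cmod w ^ m) \<le> (cmod (a m))\<^sup>2 + (cmod w ^ m)\<^sup>2"
    using sum_squares_bound[of "cmod (a m)" "cmod w ^ m"] by simp
  moreover have "0 \<le> cmod (a m) * cmod w ^ m" by simp
  ultimately have "cmod (a m) * cmod w ^ m \<le> (cmod (a m))\<^sup>2 + (cmod w ^ m)\<^sup>2" by linarith
  then show "norm (a m * w ^ m) \<le> (cmod (a m))\<^sup>2 + ((cmod w)\<^sup>2) ^ m"
    by (simp add: norm_mult norm_power power_mult[symmetric] mult.commute)
qed

lemma norm_square_powser_le:
  fixes a :: "nat \<Rightarrow> complex"
  assumes a: "summable (\<lambda>m. (cmod (a m))\<^sup>2)" and w: "cmod w < 1"
  shows "(cmod (\<Sum>m. a m * w ^ m))\<^sup>2 \<le> (\<Sum>m. (cmod (a m))\<^sup>2) / (1 - (cmod w)\<^sup>2)"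
proof (rule LIMSEQ_le_const2)
  show "(\<lambda>n. (cmod (\<Sum>m<n. a m * w ^ m))\<^sup>2) \<longlonglongrightarrow> (cmod (\<Sum>m. a m * w ^ m))\<^sup>2"
    by (intro tendsto_intros summable_LIMSEQ summable_square_powser assms)
  have w2: "(cmod w)\<^sup>2 < 1" using w by (simp add: abs_square_less_1)
  then have geo: "summable (\<lambda>m. ((cmod w)\<^sup>2) ^ m)" by (intro summable_geometric) simp
  have "(cmod (\<Sum>m<n. a m * w ^ m))\<^sup>2 \<le> (\<Sum>m. (cmod (a m))\<^sup>2) / (1 - (cmod w)\<^sup>2)" for n
  proof -
    have "cmod (\<Sum>m<n. a m * w ^ m) \<le> (\<Sum>m<n. cmod (a m) * cmod w ^ m)"
      by (rule order_trans[OF norm_sum]) (simp add: norm_mult norm_power)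
    then have "(cmod (\<Sum>m<n. a m * w ^ m))\<^sup>2 \<le> (\<Sum>m<n. cmod (a m) * cmod w ^ m)\<^sup>2"
      by (intro power_mono) auto
    also have "\<dots> \<le> (\<Sum>m<n. (cmod (a m))\<^sup>2) * (\<Sum>m<n. (cmod w ^ m)\<^sup>2)"
      by (rule Cauchy_Schwarz_ineq_sum)
    also have "(\<Sum>m<n. (cmod w ^ m)\<^sup>2) = (\<Sum>m<n. ((cmod w)\<^sup>2) ^ m)"
      by (simp add: power_mult[symmetric] mult.commute)
    also have "(\<Sum>m<n. (cmod (a m))\<^sup>2) * (\<Sum>m<n. ((cmod w)\<^sup>2) ^ m) \<le>
        (\<Sum>m. (cmod (a m))\<^sup>2) * (\<Sum>m. ((cmod w)\<^sup>2) ^ m)"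
      by (intro mult_mono sum_le_suminf a geo suminf_nonneg sum_nonneg) auto
    also have "(\<Sum>m. ((cmod w)\<^sup>2) ^ m) = 1 / (1 - (cmod w)\<^sup>2)"
      using w2 by (intro suminf_geometric) simp
    finally show ?thesis by simp
  qed
  then show "\<exists>N. \<forall>n\<ge>N. (cmod (\<Sum>m<n. a m * w ^ m))\<^sup>2 \<le>
      (\<Sum>m. (cmod (a m))\<^sup>2) / (1 - (cmod w)\<^sup>2)" by blast
qed

text \<open>The factor \<open>1 / \<bar>z - 1\<bar>\<^sup>2\<close> exactly cancels the numerator that arises from \<open>1 / (1 - \<bar>w\<bar>\<^sup>2)\<close> at
  \<open>w = z / (z - 1)\<close>, so the bound depends on the real part only: the functions are bounded on the
  closed left half-plane and decay along the negative real axis.\<close>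

lemma norm_half_series_le:
  assumes a: "summable (\<lambda>m. (cmod (a m))\<^sup>2)" and z: "Re z < 1/2"
  shows "(cmod (half_series a z))\<^sup>2 \<le> (\<Sum>m. (cmod (a m))\<^sup>2) / (1 - 2 * Re z)"
proof -
  have "z \<noteq> 1" using z by auto
  then have pos: "0 < (cmod (z - 1))\<^sup>2" by simp
  have "(cmod (half_series a z))\<^sup>2 \<le>
      ((\<Sum>m. (cmod (a m))\<^sup>2) / (1 - (cmod (z / (z - 1)))\<^sup>2)) / (cmod (z - 1))\<^sup>2"
    unfolding half_series_def norm_divide[of "suminf _"] power_divide[of "cmod (suminf _)"]
    by (intro divide_right_mono norm_square_powser_le a norm_moebius z) simp
  also have "\<dots> = (\<Sum>m. (cmod (a m))\<^sup>2) / (1 - 2 * Re z)"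
    unfolding one_minus_norm_moebius[OF z] using pos z by (simp add: field_simps)
  finally show ?thesis .
qed

lemma holomorphic_half_series:
  assumes a: "summable (\<lambda>m. (cmod (a m))\<^sup>2)"
  shows "half_series a holomorphic_on {z. Re z < 1/2}"
proof -
  have "(\<lambda>w. \<Sum>m. a m * w ^ m) holomorphic_on ball 0 1"
    using summable_sums[OF summable_square_powser[OF a]]
    by (intro power_series_holomorphic[of 0 1 a]) simp
  moreover have "(\<lambda>z. z / (z - 1)) holomorphic_on {z. Re z < 1/2}"
    by (intro holomorphic_intros) auto
  moreover have "(\<lambda>z. z / (z - 1)) ` {z. Re z < 1/2} \<subseteq> ball 0 1"
    using norm_moebius by auto
  ultimately have "(\<lambda>z. \<Sum>m. a m * (z / (z - 1)) ^ m) holomorphic_on {z. Re z < 1/2}"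
    using holomorphic_on_compose_gen[of "\<lambda>z. z / (z - 1)" "{z. Re z < 1/2}"
        "\<lambda>w. \<Sum>m. a m * w ^ m" "ball 0 1"] by (simp add: o_def)
  then show ?thesis
    unfolding half_series_def[abs_def] by (intro holomorphic_intros) auto
qed

text \<open>The map \<open>z \<mapsto> z / (z - 1)\<close> is an involution, so the power series vanishes on the whole disc.\<close>

lemma half_series_zeroD:
  assumes a: "summable (\<lambda>m. (cmod (a m))\<^sup>2)" and zero: "\<And>z. Re z < 1/2 \<Longrightarrow> half_series a z = 0"
  shows "a m = 0"
proof -
  define f where "f w = (\<Sum>m. a m * w ^ m)" for w
  have f0: "f w = 0" if w: "cmod w < 1" for w
  proof -
    define z where "z = w / (w - 1)"
    have "w \<noteq> 1" using w by auto
    then have z1: "z - 1 = 1 / (w - 1)" and inv: "z / (z - 1) = w"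
      by (auto simp: z_def field_simps)
    have "z \<noteq> 1" using z1 \<open>w \<noteq> 1\<close> by auto
    have "1 - 2 * Re z = (cmod (z - 1))\<^sup>2 - (cmod z)\<^sup>2"
      unfolding cmod_power2 by (simp add: power2_eq_square algebra_simps)
    also have "\<dots> = (1 - (cmod w)\<^sup>2) * (cmod (z - 1))\<^sup>2"
      unfolding inv[symmetric] using \<open>z \<noteq> 1\<close> by (simp add: norm_divide power_divide field_simps)
    also have "\<dots> > 0" using w \<open>z \<noteq> 1\<close> by (simp add: abs_square_less_1)
    finally have "half_series a z = 0" by (intro zero) simp
    then show ?thesis using \<open>z \<noteq> 1\<close> by (simp add: half_series_def inv f_def)
  qed
  have sums: "(\<lambda>m. a m * w ^ m) sums f w" if "cmod w < 1" for w
    unfolding f_def using summable_sums[OF summable_square_powser[OF a that]] .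
  show ?thesis
  proof (cases "m = 0")
    case True
    then show ?thesis using f0[of 0] by (simp add: f_def)
  next
    case False
    show ?thesis
    proof (rule ccontr)
      assume "a m \<noteq> 0"
      then obtain s where s: "0 < s" "\<And>z. z \<in> cball 0 s - {0} \<Longrightarrow> f z \<noteq> 0"
        using powser_0_nonzero[of 1 0 a f m] sums f0[of 0] False by auto
      \<comment> \<open>A point of both the punctured disc without zeros and the unit disc, where \<open>f\<close> vanishes.\<close>
      define w where "w = complex_of_real (min s (1/2))"
      have "cmod w = min s (1/2)" using s(1) by (simp add: w_def)
      then have "w \<in> cball 0 s - {0}" "cmod w < 1" using s(1) by (auto simp: dist_norm)
      then show False using s(2) f0 by blast
    qed
  qed
qed

text \<open>One function is holomorphic for \<open>Re z < 1/2\<close>, the other, after reflection, for \<open>Re z > -1/2\<close>; they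
  agree on the imaginary axis, hence on the strip where both are defined, and glue to an entire
  function \<open>h\<close>. Each is bounded on its closed half of the plane, so \<open>h\<close> is constant by Liouville's
  theorem, and decay along the negative real axis makes the constant zero.\<close>

lemma half_series_unique:
  assumes a: "summable (\<lambda>m. (cmod (a m))\<^sup>2)" and b: "summable (\<lambda>m. (cmod (b m))\<^sup>2)"
    and eq: "\<And>t::real. half_series a (\<i> * of_real t) = half_series b (- (\<i> * of_real t))"
  shows "a m = 0" "b m = 0"
proof -
  define L where "L = {z. Re z < 1/2}"
  define R where "R = {z. Re z > - (1/2)}"
  have op: "open L" "open R" unfolding L_def R_def by (rule open_halfspace_Re_lt open_halfspace_Re_gt)+
  have LR: "L \<union> R = UNIV" by (auto simp: L_def R_def)
  have hol_L: "half_series a holomorphic_on L"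
    unfolding L_def using holomorphic_half_series[OF a] .
  have hol_R: "(\<lambda>z. half_series b (- z)) holomorphic_on R"
  proof -
    have "half_series b \<circ> uminus holomorphic_on R"
      by (rule holomorphic_on_compose_gen[OF _ holomorphic_half_series[OF b]])
        (auto simp: R_def intro!: holomorphic_intros)
    then show ?thesis by (simp add: o_def)
  qed
  have agree: "half_series a z = half_series b (- z)" if z: "z \<in> L \<inter> R" for z
  proof -
    let ?U = "range (\<lambda>t::real. \<i> * complex_of_real t)"
    have "half_series a z - half_series b (- z) = 0"
    proof (rule analytic_continuation[where S = "L \<inter> R" and U = ?U and \<xi> = 0
          and f = "\<lambda>z. half_series a z - half_series b (- z)"])
      show "(\<lambda>z. half_series a z - half_series b (- z)) holomorphic_on L \<inter> R"
        using hol_L hol_R by (intro holomorphic_intros) (auto elim: holomorphic_on_subset)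
      show "open (L \<inter> R)" using op by blast
      show "connected (L \<inter> R)"
        unfolding L_def R_def
        by (intro convex_connected convex_Int convex_halfspace_Re_lt convex_halfspace_Re_gt)
      show "0 islimpt ?U"
        unfolding islimpt_approachable
      proof (intro allI impI)
        fix \<epsilon> :: real assume "\<epsilon> > 0"
        then show "\<exists>x'\<in>?U. x' \<noteq> 0 \<and> dist x' 0 < \<epsilon>"
          by (intro bexI[OF _ rangeI[of _ "\<epsilon> / 2"]]) (auto simp: norm_mult)
      qed
    qed (use z eq in \<open>auto simp: L_def R_def\<close>)
    then show ?thesis by simp
  qed
  define h where "h z = (if z \<in> L then half_series a z else half_series b (- z))" for z
  have "h holomorphic_on UNIV"
    unfolding h_def[abs_def] LR[symmetric]
    using holomorphic_on_If_Un[OF hol_L hol_R op] agree by auto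
  have h_R: "h z = half_series b (- z)" if "z \<in> R" for z
    using that agree[of z] by (simp add: h_def)
  define A where "A = (\<Sum>m. (cmod (a m))\<^sup>2)"
  define B where "B = (\<Sum>m. (cmod (b m))\<^sup>2)"
  have AB: "0 \<le> A" "0 \<le> B" using a b by (auto simp: A_def B_def intro!: suminf_nonneg)
  have left: "(cmod (h z))\<^sup>2 \<le> A / (1 - 2 * Re z)" if "Re z \<le> 0" for z
    using norm_half_series_le[OF a, of z] that by (simp add: h_def L_def A_def)
  have right: "(cmod (h z))\<^sup>2 \<le> B / (1 + 2 * Re z)" if "Re z \<ge> 0" for z
    using norm_half_series_le[OF b, of "- z"] h_R[of z] that by (simp add: R_def B_def)
  have "(cmod (h z))\<^sup>2 \<le> A + B" for z
  proof (cases "Re z \<le> 0")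
    case True
    have "A / (1 - 2 * Re z) \<le> A / 1" using AB True by (intro divide_left_mono) auto
    then show ?thesis using left[OF True] AB by linarith
  next
    case False
    have "B / (1 + 2 * Re z) \<le> B / 1" using AB False by (intro divide_left_mono) auto
    then show ?thesis using right[of z] False AB by linarith
  qed
  then have "cmod (h z) \<le> sqrt (A + B)" for z by (rule real_le_rsqrt)
  then have "bounded (range h)" by (auto simp: bounded_iff)
  with \<open>h holomorphic_on UNIV\<close> obtain d where d: "\<And>z. h z = d"
    using Liouville_theorem unfolding constant_on_def by blast
  have "(cmod d)\<^sup>2 \<le> A * (1 / real n)" if "n \<ge> 1" for n
  proof -
    have "(cmod d)\<^sup>2 \<le> A / (1 + 2 * real n)"
      using left[of "- of_nat n"] d by simp
    also have "\<dots> \<le> A / real n" using AB that by (intro divide_left_mono) auto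
    finally show ?thesis by simp
  qed
  moreover have "(\<lambda>n. A * (1 / real n)) \<longlonglongrightarrow> A * 0"
    by (intro tendsto_intros lim_1_over_n)
  ultimately have "(cmod d)\<^sup>2 \<le> A * 0"
    by (intro LIMSEQ_le_const[of "\<lambda>n. A * (1 / real n)"]) auto
  then have d0: "d = 0" by simp
  have "half_series a z = 0" if "Re z < 1/2" for z
    using d[of z] d0 that by (simp add: h_def L_def)
  then show "a m = 0" by (rule half_series_zeroD[OF a])
  have "half_series b z = 0" if "Re z < 1/2" for z
    using d[of "- z"] h_R[of "- z"] d0 that by (simp add: R_def)
  then show "b m = 0" by (rule half_series_zeroD[OF b])
qed

section \<open>The family \<psi>\<close>

lemma int_UNIV_split:
  "(UNIV :: int set) = range int \<union> range (\<lambda>m. - int m - 1)"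
  "range int \<inter> range (\<lambda>m. - int m - 1) = {}"
proof -
  have "x \<in> range int \<union> range (\<lambda>m. - int m - 1)" for x :: int
    by (cases x rule: int_cases3) (auto intro: image_eqI[of _ _ "nat (- x - 1)"])
  then show "(UNIV :: int set) = range int \<union> range (\<lambda>m. - int m - 1)" by blast
qed auto

lemma has_sum_int:
  fixes f :: "int \<Rightarrow> 'a::banach"
  assumes "((\<lambda>m. f (int m)) has_sum A) UNIV" "((\<lambda>m. f (- int m - 1)) has_sum B) UNIV"
  shows "(f has_sum (A + B)) UNIV"
proof -
  have "(f has_sum A) (range int)" "(f has_sum B) (range (\<lambda>m. - int m - 1))"
    using assms by (subst has_sum_reindex; simp add: inj_on_def o_def)+
  then show ?thesis
    unfolding int_UNIV_split(1) using int_UNIV_split(2) by (rule has_sum_Un_disjoint)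
qed

lemma summable_on_int:
  fixes f :: "int \<Rightarrow> 'a::banach"
  assumes "f summable_on UNIV"
  shows "(\<lambda>m. f (int m)) summable_on UNIV" "(\<lambda>m. f (- int m - 1)) summable_on UNIV"
proof -
  have "f summable_on range int" "f summable_on range (\<lambda>m. - int m - 1)"
    using assms by (auto intro: summable_on_subset_banach)
  then show "(\<lambda>m. f (int m)) summable_on UNIV" "(\<lambda>m. f (- int m - 1)) summable_on UNIV"
    by (simp_all add: summable_on_reindex inj_on_def o_def)
qed

lemma psi_nonneg:
  "psi (int m) t = - (1 / complex_of_real (sqrt 2)) *
    ((\<i> * of_real t / (\<i> * of_real t - 1)) ^ m / (\<i> * of_real t - 1))"
  by (simp add: psi_def power_divide mult.commute)

lemma psi_neg: "psi (- int m - 1) t = - cnj (psi (int m) t)"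
proof -
  have "(\<i> * complex_of_real t) ^ m / (\<i> * of_real t + 1) ^ (m + 1) =
    - ((- (\<i> * complex_of_real t)) ^ m / (- (\<i> * of_real t) - 1) ^ (m + 1))"
  proof -
    have "- (\<i> * complex_of_real t) - 1 = - (\<i> * of_real t + 1)" by simp
    then show ?thesis
      by (simp only: power_minus[of "\<i> * complex_of_real t"] power_minus[of "\<i> * complex_of_real t + 1"])
        (simp add: power_minus1_odd mult_divide_mult_cancel_left_if)
  qed
  then show ?thesis by (simp add: psi_def)
qed

text \<open>The members with negative index are the ones with nonnegative index at the reflected point
  \<open>- \<i> t\<close>, up to sign. This is what lets one half-plane estimate serve both halves of the family.\<close>

lemma psi_neg':
  "psi (- int m - 1) t = 1 / complex_of_real (sqrt 2) *
    ((- (\<i> * of_real t) / (- (\<i> * of_real t) - 1)) ^ m / (- (\<i> * of_real t) - 1))"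
  unfolding psi_neg psi_nonneg by simp

lemma product_of_halves:
  fixes s :: "'a::field"
  assumes "s * s = 2"
  shows "(1 / s * (A / X)) * (1 / s * (B / Y)) = 1 / (2 * X * Y) * (A * B)"
proof -
  have "(1 / s * (A / X)) * (1 / s * (B / Y)) = (A * B) / ((s * s) * X * Y)"
    by (simp add: mult_ac)
  then show ?thesis by (simp add: assms)
qed

lemma norm_psi_nonneg:
  "cmod (psi (int m) t) =
    1 / sqrt 2 * (cmod (\<i> * of_real t / (\<i> * of_real t - 1)) ^ m / cmod (\<i> * of_real t - 1))"
  unfolding psi_nonneg norm_mult norm_minus_cancel norm_divide[of "_ ^ _"] norm_power
  by (simp add: norm_divide)

lemma psi_product_summable:
  "summable (\<lambda>m. cmod (psi (int m) t) * cmod (psi (int m) u))"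
proof -
  let ?w = "\<lambda>t. \<i> * complex_of_real t / (\<i> * complex_of_real t - 1)"
  have "cmod (?w t) * cmod (?w u) < 1 * 1"
    by (intro mult_strict_mono norm_moebius) auto
  then have "summable (\<lambda>m. (cmod (?w t) * cmod (?w u)) ^ m)" by (intro summable_geometric) simp
  from summable_mult[OF this, of "1 / (2 * cmod (\<i> * of_real t - 1) * cmod (\<i> * of_real u - 1))"]
  show ?thesis
    unfolding norm_psi_nonneg power_mult_distrib
    by (subst product_of_halves) auto
qed

text \<open>A geometric series, whose sum is half of \<open>1 / (1 + \<i> (t - u))\<close>. The terms with negative
  index are the complex conjugates, and the two halves add up to the Cauchy kernel.\<close>

lemma half_kernel:
  "((\<lambda>m. cnj (psi (int m) t) * psi (int m) u) has_sum 1 / (2 * (1 + \<i> * (of_real t - of_real u)))) UNIV"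
proof (rule norm_summable_imp_has_sum)
  show "summable (\<lambda>m. norm (cnj (psi (int m) t) * psi (int m) u))"
    using psi_product_summable by (simp add: norm_mult)
  let ?x = "\<i> * complex_of_real t" and ?y = "\<i> * complex_of_real u"
  define q where "q = - ?x / (- ?x - 1) * (?y / (?y - 1))"
  have nz: "?x + 1 \<noteq> 0" "- ?x - 1 \<noteq> 0" "?y - 1 \<noteq> 0" "1 + ?x - ?y \<noteq> 0"
    by (auto simp: complex_eq_iff)
  have "cmod q < 1 * 1"
    unfolding q_def norm_mult[of "_ / _"] by (intro mult_strict_mono norm_moebius) auto
  then have "(\<lambda>m. 1 / (2 * (- ?x - 1) * (?y - 1)) * q ^ m) sums
      (1 / (2 * (- ?x - 1) * (?y - 1)) * (1 / (1 - q)))"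
    by (intro sums_mult geometric_sums) simp
  moreover have "cnj (psi (int m) t) * psi (int m) u = 1 / (2 * (- ?x - 1) * (?y - 1)) * q ^ m" for m
  proof -
    have s: "complex_of_real (sqrt 2) * complex_of_real (sqrt 2) = 2"
      by (simp flip: of_real_mult)
    have "cnj (psi (int m) t) =
        - (1 / complex_of_real (sqrt 2)) * ((- ?x / (- ?x - 1)) ^ m / (- ?x - 1))"
      unfolding psi_nonneg by simp
    then show ?thesis
      unfolding psi_nonneg[of m u] q_def power_mult_distrib
      using product_of_halves[OF s, of "(- ?x / (- ?x - 1)) ^ m" "- ?x - 1"
          "(?y / (?y - 1)) ^ m" "?y - 1"]
      by (simp only: mult_minus_left mult_minus_right minus_minus)
  qed
  moreover have "1 / (2 * (- ?x - 1) * (?y - 1)) * (1 / (1 - q)) = 1 / (2 * (1 + \<i> * (of_real t - of_real u)))"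
  proof -
    have "q = - ?x * ?y / ((- ?x - 1) * (?y - 1))"
      unfolding q_def times_divide_times_eq ..
    moreover have "X * Y * (A / (X * Y)) = A" if "X \<noteq> 0" "Y \<noteq> 0" for X Y A :: complex
      using that by simp
    ultimately have "(- ?x - 1) * (?y - 1) * q = - ?x * ?y"
      using nz(2,3) by blast
    then have "(- ?x - 1) * (?y - 1) * (1 - q) = (- ?x - 1) * (?y - 1) + ?x * ?y"
      unfolding right_diff_distrib by simp
    also have "\<dots> = 1 + ?x - ?y" by (simp add: algebra_simps)
    also have "\<dots> = 1 + \<i> * (of_real t - of_real u)" by (simp add: algebra_simps)
    finally have eq: "(- ?x - 1) * (?y - 1) * (1 - q) = 1 + \<i> * (of_real t - of_real u)" .
    have "1 / (2 * X * Y) * (1 / c) = 1 / (2 * (X * Y * c))" for X Y c :: complex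
      by (simp add: mult.assoc)
    then show ?thesis unfolding eq[symmetric] .
  qed
  ultimately show "(\<lambda>m. cnj (psi (int m) t) * psi (int m) u) sums
      (1 / (2 * (1 + \<i> * (of_real t - of_real u))))" by simp
qed

lemma half_kernel_add_cnj:
  "1 / (2 * (1 + \<i> * (of_real t - of_real u))) + cnj (1 / (2 * (1 + \<i> * (of_real t - of_real u)))) =
    cauchy_kernel t u"
proof -
  let ?s = "complex_of_real (t - u)"
  have nz: "1 + \<i> * ?s \<noteq> 0" "1 - \<i> * ?s \<noteq> 0" by (auto simp: complex_eq_iff)
  have "1 / (2 * (1 + \<i> * ?s)) + 1 / (2 * (1 - \<i> * ?s)) = 1 / ((1 + \<i> * ?s) * (1 - \<i> * ?s))"
  proof -
    have "1 / (2 * a) + 1 / (2 * b) = 1 / (a * b)"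
      if "a \<noteq> 0" "b \<noteq> 0" "a + b = 2" for a b :: complex
    proof -
      have "1 / (2 * a) + 1 / (2 * b) = (a + b) / (2 * (a * b))"
        using that(1,2) by (simp add: add_divide_distrib)
      then show ?thesis using that(3) by simp
    qed
    from this[OF nz] show ?thesis by simp
  qed
  also have "(1 + \<i> * ?s) * (1 - \<i> * ?s) = 1 + ?s\<^sup>2"
    by (simp add: algebra_simps power2_eq_square flip: of_real_mult)
  finally show ?thesis by (simp add: cauchy_kernel_def)
qed

lemma psi_expansion:
  "((\<lambda>m. cnj (psi m t) * psi m u) has_sum cauchy_kernel t u) UNIV"
  unfolding half_kernel_add_cnj[symmetric]
proof (rule has_sum_int[OF half_kernel])
  show "((\<lambda>m. cnj (psi (- int m - 1) t) * psi (- int m - 1) u) has_sum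
      cnj (1 / (2 * (1 + \<i> * (of_real t - of_real u))))) UNIV"
    using has_sum_cnj_iff[THEN iffD2, OF half_kernel[of t u]] by (simp add: psi_neg)
qed

lemma psi_independent: "l2_independent psi"
  unfolding l2_independent_def
proof (intro allI impI)
  fix a :: "int \<Rightarrow> complex" and m
  assume a: "(\<lambda>m. (cmod (a m))\<^sup>2) summable_on UNIV"
    and "\<forall>t. ((\<lambda>m. a m * psi m t) has_sum 0) UNIV"
  then have zero: "((\<lambda>m. a m * psi m t) has_sum 0) UNIV" for t by blast
  let ?s = "1 / complex_of_real (sqrt 2)"
  define p where "p m = a (int m)" for m
  define n where "n m = a (- int m - 1)" for m
  have sq: "summable (\<lambda>m. (cmod (p m))\<^sup>2)" "summable (\<lambda>m. (cmod (n m))\<^sup>2)"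
    unfolding p_def n_def using summable_on_int[OF a] by (auto intro: summable_on_imp_summable)
  have "half_series p (\<i> * of_real t) = half_series n (- (\<i> * of_real t))" for t
  proof -
    let ?z = "\<i> * complex_of_real t"
    have sum: "(\<lambda>m. c m * ((z / (z - 1)) ^ m / (z - 1))) sums half_series c z"
      if "summable (\<lambda>m. (cmod (c m))\<^sup>2)" "Re z < 1/2" for c z
      using sums_divide[OF summable_sums[OF summable_square_powser[OF that(1) norm_moebius[OF that(2)]]],
          of "z - 1"]
      by (simp add: half_series_def)
    have conv: "(f has_sum S) UNIV" if "f summable_on UNIV" "f sums S" for f :: "nat \<Rightarrow> complex" and S
      using has_sum_infsum[OF that(1)] that(2) sums_unique2[OF has_sum_imp_sums] by blast
    have "(\<lambda>m. - ?s * (p m * ((?z / (?z - 1)) ^ m / (?z - 1)))) sums (- ?s * half_series p ?z)"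
      by (intro sums_mult sum sq) simp
    then have "(\<lambda>m. a (int m) * psi (int m) t) sums (- ?s * half_series p ?z)"
      unfolding psi_nonneg p_def by (simp add: mult.left_commute)
    moreover have "(\<lambda>m. ?s * (n m * ((- ?z / (- ?z - 1)) ^ m / (- ?z - 1)))) sums (?s * half_series n (- ?z))"
      by (intro sums_mult sum sq) simp
    then have "(\<lambda>m. a (- int m - 1) * psi (- int m - 1) t) sums (?s * half_series n (- ?z))"
      unfolding psi_neg' n_def by (simp add: mult.left_commute)
    ultimately have "((\<lambda>m. a m * psi m t) has_sum (- ?s * half_series p ?z + ?s * half_series n (- ?z))) UNIV"
      using summable_on_int[OF has_sum_imp_summable[OF zero[of t]]]
      by (intro has_sum_int conv)
    then have "- ?s * half_series p ?z + ?s * half_series n (- ?z) = 0"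
      using zero[of t] has_sum_unique by blast
    then show ?thesis by simp
  qed
  from half_series_unique[OF sq this] have "p k = 0" "n k = 0" for k by auto
  moreover have "m \<in> range int \<union> range (\<lambda>m. - int m - 1)"
    by (simp only: int_UNIV_split(1)[symmetric] UNIV_I)
  ultimately show "a m = 0" by (auto simp: p_def n_def)
qed

section \<open>The families \<alpha> and \<beta>\<close>

lemma alpha_psi:
  "alpha m = (\<lambda>t. of_real (1 / sqrt 2) * psi (int m) t + - of_real (1 / sqrt 2) * psi (- int m - 1) t)"
  by (simp add: alpha_def psi_neg fun_eq_iff algebra_simps)

lemma beta_psi:
  "beta m = (\<lambda>t. - \<i> * of_real (1 / sqrt 2) * psi (int m) t + - \<i> * of_real (1 / sqrt 2) * psi (- int m - 1) t)"
  by (simp add: beta_def psi_neg fun_eq_iff algebra_simps complex_i_mult_minus divide_simps)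

lemma (in function_hilbert_space) comb2_mem:
  "f \<in> H \<Longrightarrow> g \<in> H \<Longrightarrow> (\<lambda>x. a * f x + b * g x) \<in> H"
  using add_mem[OF scale_mem scale_mem] .

lemma (in function_hilbert_space) ip_comb2:
  assumes "f \<in> H" "g \<in> H" "h \<in> H"
  shows "ip h (\<lambda>x. a * f x + b * g x) = cnj a * ip h f + cnj b * ip h g"
    and "ip (\<lambda>x. a * f x + b * g x) h = a * ip f h + b * ip g h"
  using assms scale_mem by (simp_all add: ip_add ip_add_right ip_scale ip_scale_right)

text \<open>For each \<open>m\<close>, the pair \<open>alpha m\<close>, \<open>beta m\<close> arises from \<open>psi m\<close>, \<open>psi (- m - 1)\<close> by a unitary
  2 by 2 matrix, which preserves both orthonormality and totality.\<close>

lemma orthonormal_basis_alpha_beta: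
  assumes "rkhs cauchy_kernel H ip"
  shows "orthonormal_basis H ip (case_sum alpha beta)"
proof -
  interpret rkhs cauchy_kernel H ip by fact
  note psi_basis = rkhs_expansion_orthonormal_basis[OF assms psi_expansion psi_independent]
  have psi: "psi m \<in> H" "ip (psi m) (psi n) = (if m = n then 1 else 0)" for m n
    using psi_basis(1) by (auto simp: orthonormal_basis_def)
  define s where "s = complex_of_real (1 / sqrt 2)"
  define d where "d = - \<i> * s"
  have coeff: "s * cnj s = 1 / 2" "d * cnj d = 1 / 2" "d * cnj s = - (s * cnj d)" "s \<noteq> 0" "d \<noteq> 0"
    by (auto simp: s_def d_def simp flip: of_real_mult)
  have eq: "alpha m = (\<lambda>t. s * psi (int m) t + - s * psi (- int m - 1) t)"
    "beta m = (\<lambda>t. d * psi (int m) t + d * psi (- int m - 1) t)" for m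
    unfolding d_def s_def by (rule alpha_psi beta_psi)+
  have mem: "alpha m \<in> H" "beta m \<in> H" for m
    unfolding eq by (intro comb2_mem psi)+
  have left: "ip (alpha m) h = s * ip (psi (int m)) h + - s * ip (psi (- int m - 1)) h"
    "ip (beta m) h = d * ip (psi (int m)) h + d * ip (psi (- int m - 1)) h" if "h \<in> H" for m h
    unfolding eq by (intro ip_comb2 psi that)+
  have right: "ip h (alpha m) = cnj s * ip h (psi (int m)) + cnj (- s) * ip h (psi (- int m - 1))"
    "ip h (beta m) = cnj d * ip h (psi (int m)) + cnj d * ip h (psi (- int m - 1))" if "h \<in> H" for m h
    unfolding eq by (intro ip_comb2 psi that)+
  have ne: "int m \<noteq> - int n - 1" "- int m - 1 \<noteq> int n" for m n by auto
  have "ip (alpha m) (alpha n) = (if m = n then 1 else 0)"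
    "ip (beta m) (beta n) = (if m = n then 1 else 0)"
    "ip (alpha m) (beta n) = 0" "ip (beta m) (alpha n) = 0" for m n
    by (auto simp: left[OF mem(1)] left[OF mem(2)] right[OF psi(1)] psi(2) ne coeff)
  then have orth: "ip (case_sum alpha beta i) (case_sum alpha beta j) = (if i = j then 1 else 0)" for i j
    by (auto split: sum.splits)
  have "f = (\<lambda>t. 0)" if f: "f \<in> H" and zero: "\<And>i. ip f (case_sum alpha beta i) = 0" for f
  proof (rule psi_basis(2)[OF f])
    fix m
    have "ip f (psi (int k)) = 0 \<and> ip f (psi (- int k - 1)) = 0" for k
    proof -
      have "ip f (alpha k) = 0" "ip f (beta k) = 0" using zero[of "Inl k"] zero[of "Inr k"] by simp_all
      then have "cnj s * (ip f (psi (int k)) - ip f (psi (- int k - 1))) = 0"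
        "cnj d * (ip f (psi (int k)) + ip f (psi (- int k - 1))) = 0"
        unfolding right[OF f] by (simp_all add: algebra_simps)
      then have "ip f (psi (int k)) - ip f (psi (- int k - 1)) = 0"
        "ip f (psi (int k)) + ip f (psi (- int k - 1)) = 0"
        using coeff(4,5) by simp_all
      then show ?thesis by (simp add: add_eq_0_iff)
    qed
    moreover have "m \<in> range int \<union> range (\<lambda>m. - int m - 1)"
      by (simp only: int_UNIV_split(1)[symmetric] UNIV_I)
    ultimately show "ip f (psi m) = 0" by auto
  qed
  then show ?thesis
    using mem by (intro orthonormal_basisI orth) (auto split: sum.splits)
qed

lemma norm_alpha_beta_le:
  "cmod (alpha m t) \<le> sqrt 2 * cmod (psi (int m) t)"
  "cmod (beta m t) \<le> sqrt 2 * cmod (psi (int m) t)"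
proof -
  let ?p = "psi (int m) t"
  have "cmod (?p + cnj ?p) \<le> 2 * cmod ?p" "cmod (?p - cnj ?p) \<le> 2 * cmod ?p"
    using norm_triangle_ineq[of ?p "cnj ?p"] norm_triangle_ineq4[of ?p "cnj ?p"] by simp_all
  then have "1 / sqrt 2 * cmod (?p + cnj ?p) \<le> 1 / sqrt 2 * (2 * cmod ?p)"
    "1 / sqrt 2 * cmod (?p - cnj ?p) \<le> 1 / sqrt 2 * (2 * cmod ?p)"
    by (intro mult_left_mono; simp)+
  moreover have "1 / sqrt 2 * (2 * cmod ?p) = sqrt 2 * cmod ?p"
    by (simp add: real_div_sqrt field_simps)
  ultimately show "cmod (alpha m t) \<le> sqrt 2 * cmod ?p" "cmod (beta m t) \<le> sqrt 2 * cmod ?p"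
    unfolding alpha_def beta_def norm_mult by (simp_all add: norm_divide norm_mult)
qed

lemma summable_alpha_beta:
  "summable (\<lambda>m. alpha m t * alpha m u)" "summable (\<lambda>m. beta m t * beta m u)"
proof -
  have le: "cmod (x m t * x m u) \<le> 2 * (cmod (psi (int m) t) * cmod (psi (int m) u))"
    if "\<And>m t. cmod (x m t) \<le> sqrt 2 * cmod (psi (int m) t)" for x :: "nat \<Rightarrow> real \<Rightarrow> complex" and m
  proof -
    have "(sqrt 2 * a) * (sqrt 2 * b) = (sqrt 2 * sqrt 2) * (a * b)" for a b
      by (simp only: mult_ac)
    then have eq: "(sqrt 2 * a) * (sqrt 2 * b) = 2 * (a * b)" for a b
      by simp
    show ?thesis
      using mult_mono[OF that[of m t] that[of m u]] unfolding norm_mult eq by simp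
  qed
  show "summable (\<lambda>m. alpha m t * alpha m u)" "summable (\<lambda>m. beta m t * beta m u)"
    by (rule summable_comparison_test'[OF summable_mult[OF psi_product_summable[of t u], of 2]],
        rule le, rule norm_alpha_beta_le)+
qed

lemma alpha_beta_expansion:
  "cauchy_kernel t u = (\<Sum>m. alpha m t * alpha m u) + (\<Sum>m. beta m t * beta m u)"
proof -
  let ?x = "\<lambda>m. cnj (psi (int m) t) * psi (int m) u"
  have "alpha m t * alpha m u + beta m t * beta m u = ?x m + cnj (?x m)" for m
  proof -
    let ?s = "complex_of_real (sqrt 2)"
    have s: "?s * ?s = 2" by (simp flip: of_real_mult)
    have "(1 / ?s * a) * (1 / ?s * b) = a * b / (?s * ?s)"
      "(1 / (\<i> * ?s) * a) * (1 / (\<i> * ?s) * b) = - (a * b) / (?s * ?s)" for a b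
      by (simp_all add: mult_ac)
    note eq = this[unfolded s]
    show ?thesis
      unfolding alpha_def beta_def eq
      by (simp add: algebra_simps add_divide_distrib diff_divide_distrib)
  qed
  moreover have "(\<lambda>m. ?x m + cnj (?x m)) sums cauchy_kernel t u"
    unfolding half_kernel_add_cnj[symmetric]
    by (intro sums_add has_sum_imp_sums half_kernel has_sum_cnj_iff[THEN iffD2])
  ultimately have "(\<lambda>m. alpha m t * alpha m u + beta m t * beta m u) sums cauchy_kernel t u" by simp
  then show ?thesis
    using suminf_add[OF summable_alpha_beta[of t u]] by (simp add: sums_iff)
qed

theorem mainTheorem3:
  "(\<forall>H ip. rkhs cauchy_kernel H ip \<longrightarrow>
      orthonormal_basis H ip psi \<and>
      orthonormal_basis H ip (case_sum alpha beta)) \<and>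
   (\<forall>t u.
      ((\<lambda>m::int. cnj (psi m t) * psi m u) has_sum cauchy_kernel t u) UNIV \<and>
      summable (\<lambda>m. alpha m t * alpha m u) \<and>
      summable (\<lambda>m. beta m t * beta m u) \<and>
      cauchy_kernel t u = (\<Sum>m. alpha m t * alpha m u) + (\<Sum>m. beta m t * beta m u))"
proof (intro conjI allI impI)
  fix H ip assume "rkhs cauchy_kernel H ip"
  then show "orthonormal_basis H ip psi" "orthonormal_basis H ip (case_sum alpha beta)"
    by (rule rkhs_expansion_orthonormal_basis(1)[OF _ psi_expansion psi_independent]
        orthonormal_basis_alpha_beta)+
qed (rule psi_expansion summable_alpha_beta alpha_beta_expansion)+

end
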